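(* For all integers $1\le r\le n$, each of the polynomials $A_{n,r}(t)$, $J_{n,r}(t)$ and $\overline{Q}_n(t)$ has only real, distinct, and nonpositive roots.
   Context: For a sequence $\pi=\pi_1\cdots\pi_s$ of positive integers and $r\ge1$, let $\operatorname{exc}_r(\pi)=|\{i\in\{1,\dots,s\}:\pi_i\ge i+r\}|$ and $\operatorname{exc}(\pi)=\operatorname{exc}_1(\pi)$. Let $A_{n,r}(t)=\sum_{\pi\in S_n}t^{\operatorname{exc}_r(\pi)}$, where $S_n$ is the set of permutations of $\{1,\dots,n\}$ written in one-line notation. Let $J_{n,r}(t)=\sum_{\pi}t^{\operatorname{exc}(\pi)}$, summing over all injections $\pi:\{1,\dots,n-r\}\to\{1,\dots,n\}$, identified with the sequences $\pi_1\cdots\pi_{n-r}$ of their values. Let $\overline{Q}_n(t)=\sum_{\pi}t^{\operatorname{des}(\pi)}$, summing over all quasi-Stirling permutations of size $n$: permutations $\pi_1\cdots\pi_{2n}$ of the multiset $\{1,1,\dots,n,n\}$ with no indices $i<j<k<\ell$ with $\pi_i=\pi_k$ and $\pi_j=\pi_\ell$; here $i\in\{1,\dots,2n\}$ is a descent if $\pi_i>\pi_{i+1}$ or $i=2n$, and $\operatorname{des}$ counts descents. *)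

theory Defs
  imports Complex_Main "HOL-Computational_Algebra.Polynomial"
begin

text \<open>Sequences are lists; position i (1-based) of xs is xs ! (i - 1).\<close>

definition exc_r :: "nat \<Rightarrow> nat list \<Rightarrow> nat" where
  "exc_r r xs = card {i \<in> {1..length xs}. xs ! (i - 1) \<ge> i + r}"

definition exc :: "nat list \<Rightarrow> nat" where
  "exc xs = exc_r 1 xs"

definition perms :: "nat \<Rightarrow> nat list set" where
  "perms n = {xs. distinct xs \<and> set xs = {1..n}}"

text \<open>Injections {1..n-r} -> {1..n}, as sequences of their values.\<close>
definition injs :: "nat \<Rightarrow> nat \<Rightarrow> nat list set" where
  "injs n r = {xs. length xs = n - r \<and> distinct xs \<and> set xs \<subseteq> {1..n}}"

definition quasi_stirling :: "nat \<Rightarrow> nat list set" where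
  "quasi_stirling n = {xs. mset xs = mset ([1..<n+1] @ [1..<n+1]) \<and>
     \<not> (\<exists>i j k l. i < j \<and> j < k \<and> k < l \<and> l < length xs \<and>
            xs ! i = xs ! k \<and> xs ! j = xs ! l)}"

definition des :: "nat list \<Rightarrow> nat" where
  "des xs = card {i \<in> {1..length xs}. i = length xs \<or> xs ! (i - 1) > xs ! i}"

definition A_poly :: "nat \<Rightarrow> nat \<Rightarrow> real poly" where
  "A_poly n r = (\<Sum>xs\<in>perms n. monom 1 (exc_r r xs))"

definition J_poly :: "nat \<Rightarrow> nat \<Rightarrow> real poly" where
  "J_poly n r = (\<Sum>xs\<in>injs n r. monom 1 (exc xs))"

definition Qbar_poly :: "nat \<Rightarrow> real poly" where
  "Qbar_poly n = (\<Sum>xs\<in>quasi_stirling n. monom 1 (des xs))"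

definition real_distinct_nonpos_roots :: "real poly \<Rightarrow> bool" where
  "real_distinct_nonpos_roots p \<longleftrightarrow>
     rsquarefree (map_poly complex_of_real p) \<and>
     (\<forall>z. poly (map_poly complex_of_real p) z = 0 \<longrightarrow> z \<in> \<real> \<and> Re z \<le> 0)"

end

theory Submission
  imports Defs "HOL-Computational_Algebra.Computational_Algebra" "HOL-Library.Sublist"
begin

text \<open>
  Prepending a new first position and a new smallest value to an injection shows that, as \<open>n\<close> grows with
  \<open>r\<close> fixed, both \<open>A_poly\<close> and \<open>J_poly\<close> satisfy \<open>h' = (s + (n + 1 - s) t) h + t (1 - t) dh/dt\<close>, with
  \<open>s = r\<close> and \<open>s = 1\<close> respectively. At consecutive (negative, simple) roots of \<open>h\<close> the values of \<open>h'\<close>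
  alternate in sign, so the intermediate value theorem yields one more negative simple root.

  For the quasi-Stirling permutations one shows \<open>Qbar_poly n = t * J_poly (2 n) (n + 1)\<close>. A quasi-Stirling
  word is a plane forest: every letter encloses a quasi-Stirling word. Its descents are the
  cyclic descents, at each vertex, of the vertex followed by its children, and the cyclic descent
  distribution does not depend on the relative size of the vertex label. Hence the exponential
  generating functions \<open>P\<close> of \<open>Qbar_poly\<close> and \<open>E\<close> of the Eulerian polynomials satisfy \<open>P = E(z P)\<close>, and
  Lagrange inversion gives \<open>(n + 1) [z^n] P = [z^n] E^(n + 1)\<close>, which is compared with the
  expansion of \<open>t J / (1 - t)^(2 n + 1)\<close> obtained from the recurrence.
\<close>

section \<open>Real-rootedness\<close>

lemma poly_eq_smult_prod_roots:
  fixes p :: "'a :: idom poly"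
  assumes "finite X" "degree p = card X" "\<And>x. x \<in> X \<Longrightarrow> poly p x = 0"
  shows "p = smult (lead_coeff p) (\<Prod>x\<in>X. [:- x, 1:])"
proof -
  let ?q = "\<Prod>x\<in>X. [:- x, 1:]"
  have lc: "lead_coeff ?q = 1"
    by (simp add: lead_coeff_prod)
  have deg: "degree ?q = card X"
    using assms(1) by (subst degree_prod_eq_sum_degree) auto
  show ?thesis
  proof (cases "p = 0")
    case False
    then show ?thesis
      using assms lc deg
      by (intro poly_eqI_degree_lead_coeff[where A = X and n = "card X"])
         (auto simp: poly_prod prod_zero_iff)
  qed auto
qed

text \<open>At a root \<open>a\<close> the product rule leaves only the product of the other
  factors, which does not vanish there.\<close>

lemma rsquarefree_smult_prod_linear:
  fixes c :: "'a :: field_char_0"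
  assumes "finite X" "c \<noteq> 0"
  shows "rsquarefree (smult c (\<Prod>x\<in>X. [:- x, 1:]))"
proof -
  let ?q = "\<Prod>x\<in>X. [:- x, 1:]"
  have "poly (pderiv ?q) a \<noteq> 0" if "poly ?q a = 0" for a
  proof -
    have a: "a \<in> X"
      using that assms by (auto simp: poly_prod)
    have "?q = [:- a, 1:] * (\<Prod>x\<in>X - {a}. [:- x, 1:])"
      using a assms by (subst prod.remove) auto
    then have "poly (pderiv ?q) a = poly (\<Prod>x\<in>X - {a}. [:- x, 1:]) a"
      by (simp only: pderiv_mult) (simp add: pderiv_pCons)
    then show ?thesis
      using assms by (auto simp: poly_prod)
  qed
  then show ?thesis
    using assms by (auto simp: rsquarefree_roots pderiv_smult)
qed

lemma poly_map_poly_of_real: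
  "poly (map_poly of_real p) (of_real x :: 'a :: {comm_ring_1, real_algebra_1}) = of_real (poly p x)"
  by (induction p) (auto simp: map_poly_pCons)

text \<open>As many real roots as the degree leave no room for others, so the complex polynomial
  splits over the image of \<open>X\<close>.\<close>

lemma real_distinct_nonpos_rootsI:
  assumes "finite X" "degree p = card X" "p \<noteq> 0"
    and "\<And>x. x \<in> X \<Longrightarrow> poly p x = 0 \<and> x \<le> 0"
  shows "real_distinct_nonpos_roots p"
proof -
  let ?q = "map_poly complex_of_real p" and ?Y = "complex_of_real ` X"
  have inj: "inj_on complex_of_real X"
    by (auto intro: inj_onI)
  have "finite ?Y" "degree ?q = card ?Y"
    using assms inj by (auto simp: card_image degree_map_poly)
  moreover have "poly ?q y = 0" if "y \<in> ?Y" for y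
    using that assms(4) by (auto simp: poly_map_poly_of_real)
  ultimately have q: "?q = smult (lead_coeff ?q) (\<Prod>y\<in>?Y. [:- y, 1:])"
    by (intro poly_eq_smult_prod_roots)
  have lc: "lead_coeff ?q \<noteq> 0"
    using assms(3) by (simp add: map_poly_eq_0_iff)
  have "rsquarefree ?q"
    by (subst q, rule rsquarefree_smult_prod_linear) (use lc \<open>finite ?Y\<close> in auto)
  moreover have "z \<in> \<real> \<and> Re z \<le> 0" if "poly ?q z = 0" for z
  proof -
    from that have "poly (smult (lead_coeff ?q) (\<Prod>y\<in>?Y. [:- y, 1:])) z = 0"
      using q by simp
    then have "z \<in> ?Y"
      using lc \<open>finite ?Y\<close> by (auto simp: poly_prod)
    then show ?thesis
      using assms(4) by auto
  qed
  ultimately show ?thesis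
    by (auto simp: real_distinct_nonpos_roots_def)
qed

section \<open>Sign alternation and the creation of one more root\<close>

definition has_neg_simple_roots :: "nat \<Rightarrow> real poly \<Rightarrow> bool" where
  "has_neg_simple_roots k p \<longleftrightarrow> degree p = k \<and> lead_coeff p > 0 \<and>
     (\<exists>x. (\<forall>i<k. poly p (x i) = 0 \<and> x i < 0) \<and> (\<forall>i<k. \<forall>j<i. x i < x j))"

lemma has_neg_simple_rootsE:
  assumes "has_neg_simple_roots k p"
  obtains X where "finite X" "card X = k" "degree p = k" "p \<noteq> 0"
    "\<And>x. x \<in> X \<Longrightarrow> poly p x = 0 \<and> x < 0"
proof -
  obtain x where x: "\<forall>i<k. poly p (x i) = 0 \<and> x i < 0" "\<forall>i<k. \<forall>j<i. x i < x j"
    using assms by (auto simp: has_neg_simple_roots_def)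
  have "inj_on x {..<k}"
    by (rule linorder_inj_onI) (use x(2) in \<open>force+\<close>)
  then show thesis
    using assms x(1) by (intro that[of "x ` {..<k}"]) (auto simp: has_neg_simple_roots_def card_image)
qed

lemma has_neg_simple_roots_imp_real_distinct_nonpos_roots:
  assumes "has_neg_simple_roots k p"
  shows "real_distinct_nonpos_roots p"
  using assms
  by (elim has_neg_simple_rootsE, intro real_distinct_nonpos_rootsI) (auto intro: less_imp_le)

text \<open>The factor t adds the root 0, which is new because all roots of \<open>p\<close> are
  strictly negative.\<close>

lemma real_distinct_nonpos_roots_monom_mult:
  assumes "has_neg_simple_roots k p"
  shows "real_distinct_nonpos_roots ([:0, 1:] * p)"
  using assms
proof (rule has_neg_simple_rootsE)
  fix X
  assume X: "finite X" "card X = k" "degree p = k" "p \<noteq> 0"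
    and roots: "\<And>x. x \<in> X \<Longrightarrow> poly p x = 0 \<and> x < 0"
  have "0 \<notin> X"
    using roots[of 0] by blast
  have "degree ([:0, 1:] * p) = Suc k"
    using X by (subst degree_mult_eq) simp_all
  show ?thesis
  proof (rule real_distinct_nonpos_rootsI[of "insert 0 X"])
    show "degree ([:0, 1:] * p) = card (insert 0 X)"
      using X \<open>0 \<notin> X\<close> \<open>degree _ = Suc k\<close> by simp
    show "poly ([:0, 1:] * p) x = 0 \<and> x \<le> 0" if "x \<in> insert 0 X" for x
      using that roots[of x] by fastforce
  qed (use X in simp_all)
qed

text \<open>The roots decrease with the index, so exactly the \<open>i\<close> factors with
  \<open>j < i\<close> are negative. Up to a positive constant the product is the derivative at
  \<open>x i\<close>.\<close>

lemma sign_prod_diff: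
  fixes x :: "nat \<Rightarrow> real"
  assumes "i < k" "\<forall>i<k. \<forall>j<i. x i < x j"
  shows "(-1) ^ i * (\<Prod>j\<in>{..<k} - {i}. x i - x j) > 0"
proof -
  have split: "{..<k} - {i} = {..<i} \<union> {i<..<k}"
    using assms(1) by auto
  have "(\<Prod>j\<in>{..<k} - {i}. x i - x j) = (\<Prod>j<i. x i - x j) * (\<Prod>j\<in>{i<..<k}. x i - x j)"
    unfolding split by (subst prod.union_disjoint) auto
  also have "(\<Prod>j<i. x i - x j) = (\<Prod>j<i. (-1) * (x j - x i))"
    by simp
  also have "\<dots> = (-1) ^ i * (\<Prod>j<i. x j - x i)"
    by (subst prod.distrib) simp
  finally have eq: "(-1) ^ i * (\<Prod>j\<in>{..<k} - {i}. x i - x j)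
      = ((-1) ^ i * (-1) ^ i) * ((\<Prod>j<i. x j - x i) * (\<Prod>j\<in>{i<..<k}. x i - x j))"
    by (simp only: mult_ac)
  have "(-1) ^ i * (-1) ^ i = (1::real)"
    by (simp flip: power_add)
  moreover have "(\<Prod>j<i. x j - x i) > 0" "(\<Prod>j\<in>{i<..<k}. x i - x j) > 0"
    using assms by (auto intro!: prod_pos)
  ultimately show ?thesis
    unfolding eq by simp
qed

lemma poly_sign_at_minus_infinity:
  fixes p :: "real poly"
  assumes "lead_coeff p > 0"
  shows "\<exists>y<b. (-1) ^ degree p * poly p y > 0"
proof -
  \<comment> \<open>Reflection moves minus infinity to plus infinity, and the sign makes the leading
    coefficient positive.\<close>
  let ?q = "smult ((-1) ^ degree p) (pcompose p [:0, -1:])"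
  have "lead_coeff (pcompose p [:0, -1:]) = lead_coeff p * (-1) ^ degree p"
    by (subst lead_coeff_comp) auto
  moreover have "(-1) ^ degree p * (-1) ^ degree p = (1::real)"
    by (simp flip: power_add)
  ultimately have lc: "lead_coeff ?q > 0"
    using assms by (simp add: mult.left_commute)
  then obtain n where "\<And>x. x \<ge> n \<Longrightarrow> poly ?q x \<ge> lead_coeff ?q"
    using poly_pinfty_gt_lc by blast
  then have "poly ?q (max n (1 - b)) > 0"
    using lc by (meson less_le_trans max.cobounded1)
  then show ?thesis
    by (intro exI[of _ "- max n (1 - b)"]) (auto simp: poly_pcompose)
qed

text \<open>The value at 0 is \<open>a\<close> times \<open>poly h 0\<close>, the values at the
  roots of \<open>h\<close> alternate with its derivative, and the leading term fixes the sign far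
  to the left. This gives k + 2 points of alternating sign, hence k + 1 roots.\<close>

lemma has_neg_simple_roots_step:
  assumes h: "has_neg_simple_roots k h" and ab: "a > 0" "b > real k"
  shows "has_neg_simple_roots (Suc k) ([:a, b:] * h + [:0, 1, -1:] * pderiv h)"
    (is "has_neg_simple_roots _ ?g")
proof -
  from h obtain x where x: "\<forall>i<k. poly h (x i) = 0 \<and> x i < 0" "\<forall>i<k. \<forall>j<i. x i < x j"
    and deg: "degree h = k" and c: "lead_coeff h > 0"
    by (auto simp: has_neg_simple_roots_def)
  define c where "c = lead_coeff h"
  have inj: "inj_on x {..<k}"
    by (rule linorder_inj_onI) (use x(2) in \<open>force+\<close>)
  have "h = smult c (\<Prod>y\<in>x ` {..<k}. [:- y, 1:])"
    unfolding c_def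
    by (rule poly_eq_smult_prod_roots) (use x(1) deg inj in \<open>auto simp: card_image\<close>)
  also have "(\<Prod>y\<in>x ` {..<k}. [:- y, 1:]) = (\<Prod>i<k. [:- x i, 1:])"
    using inj by (simp add: prod.reindex)
  finally have prod: "h = smult c (\<Prod>i<k. [:- x i, 1:])" .
  \<comment> \<open>The term -t^2 times the derivative contributes -k c; the bound on
    \<open>b\<close> keeps the sum positive.\<close>
  have coeff: "coeff ?g (Suc k) = (b - real k) * c"
  proof -
    have "coeff h (Suc k) = 0"
      using deg by (simp add: coeff_eq_0)
    then show ?thesis
      using deg by (cases k) (auto simp: coeff_pderiv c_def algebra_simps coeff_pCons)
  qed
  have "degree ?g \<le> Suc k"
  proof (rule degree_add_le)
    show "degree ([:a, b:] * h) \<le> Suc k"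
      using degree_mult_le[of "[:a, b:]" h] deg by (auto split: if_splits)
    show "degree ([:0, 1, - 1:] * pderiv h) \<le> Suc k"
      using degree_mult_le[of "[:0, 1, -1:]" "pderiv h"] deg
      by (cases k) (auto simp: degree_pderiv pderiv_eq_0_iff[THEN iffD2])
  qed
  then have deg_g: "degree ?g = Suc k"
    using coeff ab c by (intro antisym le_degree) (auto simp: c_def)
  have lc_g: "lead_coeff ?g > 0"
    unfolding deg_g coeff using ab c by (auto simp: c_def)
  have deriv: "poly (pderiv h) (x i) = c * (\<Prod>j\<in>{..<k} - {i}. x i - x j)" if "i < k" for i
  proof -
    let ?R = "smult c (\<Prod>j\<in>{..<k} - {i}. [:- x j, 1:])"
    have "h = [:- x i, 1:] * ?R"
      using that by (subst prod, subst prod.remove[of _ i]) auto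
    then have "pderiv h = [:- x i, 1:] * pderiv ?R + ?R"
      by (simp only: pderiv_mult) (simp add: pderiv_pCons)
    then have "poly (pderiv h) (x i) = poly ?R (x i)"
      by simp
    then show ?thesis
      by (simp add: poly_prod)
  qed
  obtain z where z: "z < (if k = 0 then 0 else x (k - 1))" "(-1) ^ Suc k * poly ?g z > 0"
    using poly_sign_at_minus_infinity[OF lc_g] deg_g by metis
  \<comment> \<open>The sample points in decreasing order: 0, the roots of \<open>h\<close>, and the
    point \<open>z\<close> to the left of them all.\<close>
  define y where "y j = (if j = 0 then 0 else if j \<le> k then x (j - 1) else z)" for j
  have dec: "y (Suc j) < y j" if "j \<le> k" for j
  proof (cases "j = k")
    case True
    then show ?thesis
      using z(1) by (cases k) (auto simp: y_def)
  next
    case False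
    then show ?thesis
      using that x by (cases j) (auto simp: y_def)
  qed
  have sign: "(-1) ^ j * poly ?g (y j) > 0" if "j \<le> Suc k" for j
  proof -
    have "j = 0 \<or> (\<exists>i<k. j = Suc i) \<or> j = Suc k"
      using that by (cases j) auto
    then consider "j = 0" | i where "j = Suc i" "i < k" | "j = Suc k"
      by blast
    then show ?thesis
    proof cases
      case 1
      have "poly h 0 = c * (\<Prod>i<k. - x i)"
        by (subst prod) (simp add: poly_prod)
      moreover have "(\<Prod>i<k. - x i) > 0"
        using x(1) by (intro prod_pos) auto
      ultimately show ?thesis
        using 1 ab c by (auto simp: y_def c_def)
    next
      case 2
      have "y j = x i" "poly h (x i) = 0"
        using 2 x(1) by (simp_all add: y_def)
      then have "poly ?g (y j) = (x i * (1 - x i)) * poly (pderiv h) (x i)"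
        by (simp add: algebra_simps)
      also note deriv[OF 2(2)]
      finally have "(-1) ^ j * poly ?g (y j)
          = (- x i * (1 - x i)) * (c * ((-1) ^ i * (\<Prod>j\<in>{..<k} - {i}. x i - x j)))"
        by (simp only: 2(1) power_Suc mult_ac mult_minus_left mult_minus_right mult_1_left)
      moreover have "- x i * (1 - x i) > 0"
      proof -
        have "x i < 0"
          using x(1) 2(2) by blast
        then show ?thesis
          by (intro mult_pos_pos) simp_all
      qed
      ultimately show ?thesis
        using sign_prod_diff[OF 2(2) x(2)] c by (simp only: c_def mult_pos_pos)
    next
      case 3
      then show ?thesis
        using z by (auto simp: y_def)
    qed
  qed
  have "\<exists>w. y (Suc j) < w \<and> w < y j \<and> poly ?g w = 0" if "j \<le> k" for j
  proof -
    have "(-1) ^ j * poly ?g (y j) > 0" "(-1) ^ j * poly ?g (y (Suc j)) < 0"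
      using sign[of j] sign[of "Suc j"] that by auto
    then have "poly ?g (y (Suc j)) * poly ?g (y j) < 0"
      by (cases "even j") (auto simp: mult_neg_pos mult_pos_neg)
    then show ?thesis
      using dec[OF that] poly_IVT by blast
  qed
  then obtain w where w: "\<And>j. j \<le> k \<Longrightarrow> y (Suc j) < w j \<and> w j < y j \<and> poly ?g (w j) = 0"
    by metis
  have y_mono: "y i \<le> y j" if "j \<le> i" "i \<le> Suc k" for i j
    using that
  proof (induction i rule: dec_induct)
    case (step n)
    then show ?case
      using dec[of n] by simp
  qed simp
  have "w i < w j" if "i \<le> k" "j < i" for i j
    using w[of i] w[of j] y_mono[of "Suc j" i] that by force
  moreover have "w i < 0" if "i \<le> k" for i
    using w[OF that] y_mono[of 0 i] that by (force simp: y_def)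
  ultimately show ?thesis
    unfolding has_neg_simple_roots_def
    using deg_g lc_g w by (intro conjI exI[of _ w]) (auto simp: less_Suc_eq_le)
qed

section \<open>Excedances of injections\<close>

text \<open>Keeping the number \<open>q\<close> of missing positions apart from the excedance gap
  \<open>s\<close> lets one recurrence serve both \<open>A_poly\<close> (\<open>q = 0\<close>) and
  \<open>J_poly\<close> (\<open>s = 1\<close>).\<close>

definition inj_exc_poly :: "nat \<Rightarrow> nat \<Rightarrow> nat \<Rightarrow> real poly" where
  "inj_exc_poly n q s = (\<Sum>xs\<in>injs n q. monom 1 (exc_r s xs))"

lemma J_poly_eq: "J_poly n r = inj_exc_poly n r 1"
  by (simp add: J_poly_def inj_exc_poly_def exc_def)

lemma perms_eq_injs: "perms n = injs n 0"
proof -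
  have "set xs = {1..n} \<longleftrightarrow> length xs = n \<and> set xs \<subseteq> {1..n}" if "distinct xs" for xs
  proof
    assume "set xs = {1..n}"
    then show "length xs = n \<and> set xs \<subseteq> {1..n}"
      using distinct_card[OF that] by simp
  next
    assume "length xs = n \<and> set xs \<subseteq> {1..n}"
    then show "set xs = {1..n}"
      using distinct_card[OF that] by (intro card_subset_eq) simp_all
  qed
  then show ?thesis
    by (auto simp: perms_def injs_def)
qed

lemma A_poly_eq: "A_poly n r = inj_exc_poly n 0 r"
  by (simp add: A_poly_def inj_exc_poly_def perms_eq_injs)

text \<open>Insertion of a new first position and a new smallest value: the new first entry \<open>v\<close> displaces
  the entry that equals \<open>v\<close> after the shift, if there is one, and that entry becomes \<open>1\<close>.\<close>

definition inj_insert :: "nat \<Rightarrow> nat list \<Rightarrow> nat list" where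
  "inj_insert v xs = v # map (\<lambda>x. if Suc x = v then 1 else Suc x) xs"

text \<open>Inverse of \<open>inj_insert\<close>: an entry 1 after the head can only be the
  displaced one, whose old value was one less than the head.\<close>

definition inj_remove :: "nat list \<Rightarrow> nat list" where
  "inj_remove ys = map (\<lambda>y. if y = 1 then hd ys - 1 else y - 1) (tl ys)"

lemma inj_remove_insert:
  assumes "0 \<notin> set xs"
  shows "inj_remove (inj_insert v xs) = xs"
  unfolding inj_remove_def inj_insert_def list.sel map_map
proof (rule map_idI)
  fix x assume "x \<in> set xs"
  then have "x \<noteq> 0"
    using assms by metis
  then show "((\<lambda>y. if y = 1 then v - 1 else y - 1) \<circ> (\<lambda>x. if Suc x = v then 1 else Suc x)) x = x"
    by auto
qed

lemma inj_insert_remove: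
  assumes "0 \<notin> set (v # zs)" "v \<notin> set zs"
  shows "inj_insert v (inj_remove (v # zs)) = v # zs"
  unfolding inj_remove_def inj_insert_def list.sel map_map list.inject
proof (intro conjI refl map_idI)
  fix y assume "y \<in> set zs"
  then have "y \<noteq> v" "v \<noteq> 0" "y \<noteq> 0"
    using assms by (auto, cases "y = 0", auto)
  then show "((\<lambda>x. if Suc x = v then 1 else Suc x) \<circ> (\<lambda>y. if y = 1 then v - 1 else y - 1)) y = y"
    by auto
qed

lemma inj_insert_in_injs:
  assumes "q \<le> n" "v \<in> {1..Suc n}" "xs \<in> injs n q"
  shows "inj_insert v xs \<in> injs (Suc n) q"
proof -
  define f where "f = (\<lambda>x. if Suc x = v then 1 else Suc x)"
  have xs: "length xs = n - q" "distinct xs" "set xs \<subseteq> {1..n}"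
    using assms(3) by (auto simp: injs_def)
  have f: "v \<noteq> f x" "f x \<in> {1..Suc n}" if "x \<in> set xs" for x
  proof -
    have "x \<ge> 1" "x \<le> n"
      using that xs(3) by auto
    then show "v \<noteq> f x" "f x \<in> {1..Suc n}"
      by (simp_all add: f_def)
  qed
  have "inj_on f (set xs)"
  proof (rule inj_onI)
    fix x y assume "x \<in> set xs" "y \<in> set xs" and eq: "f x = f y"
    then have "x \<ge> 1" "y \<ge> 1"
      using xs(3) by auto
    then show "x = y"
      using eq by (cases "Suc x = v"; cases "Suc y = v") (simp_all add: f_def)
  qed
  then have "distinct (v # map f xs)" "set (v # map f xs) \<subseteq> {1..Suc n}"
    using f xs(2) assms(2) by (auto simp: distinct_map)
  then show ?thesis
    using assms(1) xs(1) by (simp add: injs_def inj_insert_def Suc_diff_le flip: f_def)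
qed

lemma inj_remove_in_injs:
  assumes "q \<le> n" "v # zs \<in> injs (Suc n) q"
  shows "inj_remove (v # zs) \<in> injs n q"
proof -
  define f where "f = (\<lambda>y. if y = 1 then v - 1 else y - 1)"
  have zs: "length zs = n - q" "distinct zs" "v \<notin> set zs" "1 \<le> v" "v \<le> Suc n" "set zs \<subseteq> {1..Suc n}"
    using assms by (simp_all add: injs_def Suc_diff_le)
  have y: "1 \<le> y" "y \<le> Suc n" "y \<noteq> v" if "y \<in> set zs" for y
    using that zs by auto
  have "f y \<in> {1..n}" if "y \<in> set zs" for y
    using y[OF that] zs(4,5) by (simp add: f_def, presburger)
  moreover have "inj_on f (set zs)"
  proof (rule inj_onI)
    fix x y assume "x \<in> set zs" "y \<in> set zs" and eq: "f x = f y"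
    from y[OF this(1)] y[OF this(2)] show "x = y"
      using eq zs(4) by (cases "x = 1"; cases "y = 1") (simp_all add: f_def)
  qed
  ultimately have "distinct (map f zs)" "set (map f zs) \<subseteq> {1..n}"
    using zs(2) by (auto simp: distinct_map)
  moreover have "inj_remove (v # zs) = map f zs"
    by (simp only: inj_remove_def f_def list.sel)
  ultimately show ?thesis
    using zs(1) by (simp add: injs_def)
qed

lemma bij_betw_inj_insert:
  assumes "q \<le> n"
  shows "bij_betw (\<lambda>(v, xs). inj_insert v xs) ({1..Suc n} \<times> injs n q) (injs (Suc n) q)"
proof (rule bij_betw_byWitness[where f' = "\<lambda>ys. (hd ys, inj_remove ys)"])
  have Cons: "\<exists>v zs. ys = v # zs \<and> v \<in> {1..Suc n} \<and> v \<notin> set zs \<and> 0 \<notin> set (v # zs)"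
    if "ys \<in> injs (Suc n) q" for ys
    using that assms by (cases ys) (auto simp: injs_def)
  show "\<forall>a\<in>{1..Suc n} \<times> injs n q.
      (hd (case a of (v, xs) \<Rightarrow> inj_insert v xs), inj_remove (case a of (v, xs) \<Rightarrow> inj_insert v xs)) = a"
  proof (intro ballI)
    fix a assume a: "a \<in> {1..Suc n} \<times> injs n q"
    then have "0 \<notin> set (snd a)"
      by (auto simp: injs_def)
    then show "(hd (case a of (v, xs) \<Rightarrow> inj_insert v xs), inj_remove (case a of (v, xs) \<Rightarrow> inj_insert v xs)) = a"
      by (cases a) (simp add: inj_remove_insert, simp add: inj_insert_def)
  qed
  show "\<forall>ys\<in>injs (Suc n) q. (case (hd ys, inj_remove ys) of (v, xs) \<Rightarrow> inj_insert v xs) = ys"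
  proof
    fix ys assume "ys \<in> injs (Suc n) q"
    from Cons[OF this] show "(case (hd ys, inj_remove ys) of (v, xs) \<Rightarrow> inj_insert v xs) = ys"
      using inj_insert_remove by auto
  qed
  show "(\<lambda>(v, xs). inj_insert v xs) ` ({1..Suc n} \<times> injs n q) \<subseteq> injs (Suc n) q"
    using inj_insert_in_injs[OF assms] by auto
  show "(\<lambda>ys. (hd ys, inj_remove ys)) ` injs (Suc n) q \<subseteq> {1..Suc n} \<times> injs n q"
  proof (rule image_subsetI)
    fix ys assume "ys \<in> injs (Suc n) q"
    with Cons[OF this] show "(hd ys, inj_remove ys) \<in> {1..Suc n} \<times> injs n q"
      using inj_remove_in_injs[OF assms] by auto
  qed
qed

lemma finite_injs [simp]: "finite (injs n q)"
  by (rule finite_subset[OF _ finite_lists_length_eq[of "{1..n}" "n - q"]]) (auto simp: injs_def)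

section \<open>Effect of the insertion on excedances\<close>

lemma exc_r_Cons:
  "exc_r s (v # ys) = (if v > s then 1 else 0) + exc_r (Suc s) ys"
proof -
  let ?E = "{i \<in> {1..length ys}. ys ! (i - 1) \<ge> i + Suc s}"
  have "{i \<in> {1..length (v # ys)}. (v # ys) ! (i - 1) \<ge> i + s} = (if v > s then {1} else {}) \<union> Suc ` ?E"
    (is "?L = ?R")
  proof (rule set_eqI)
    fix i
    show "i \<in> ?L \<longleftrightarrow> i \<in> ?R"
      by (cases i; cases "i - 1") (auto simp: image_iff)
  qed
  moreover have "card (Suc ` ?E) = card ?E"
    by (simp add: card_image)
  ultimately show ?thesis
    by (auto simp: exc_r_def card_insert_if)
qed

text \<open>Position and value of an old entry both rise by one, so its status persists, except that
  a displaced entry becomes 1 and stops being an excedance.\<close>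

lemma exc_r_inj_insert:
  "exc_r s (inj_insert v xs) = (if v > s then 1 else 0) +
     card {i \<in> {1..length xs}. xs ! (i - 1) \<ge> i + s \<and> Suc (xs ! (i - 1)) \<noteq> v}"
proof -
  have "{i \<in> {1..length xs}. map (\<lambda>x. if Suc x = v then 1 else Suc x) xs ! (i - 1) \<ge> i + Suc s}
      = {i \<in> {1..length xs}. xs ! (i - 1) \<ge> i + s \<and> Suc (xs ! (i - 1)) \<noteq> v}"
  proof (rule Collect_cong, rule conj_cong[OF refl])
    fix i assume "i \<in> {1..length xs}"
    then show "map (\<lambda>x. if Suc x = v then 1 else Suc x) xs ! (i - 1) \<ge> i + Suc s \<longleftrightarrow>
        xs ! (i - 1) \<ge> i + s \<and> Suc (xs ! (i - 1)) \<noteq> v"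
      by (subst nth_map) auto
  qed
  then show ?thesis
    unfolding inj_insert_def exc_r_Cons by (simp add: exc_r_def)
qed

text \<open>With e excedances in \<open>xs\<close>, the e values of \<open>v\<close> that displace
  one and the s values \<open>v <= s\<close> keep the count; the other n + 1 - s - e values raise it
  by one. The terms proportional to e form the derivative part.\<close>

lemma sum_exc_r_inj_insert:
  assumes xs: "xs \<in> injs n q" and s: "s \<le> Suc n"
  shows "(\<Sum>v\<in>{1..Suc n}. monom (1::real) (exc_r s (inj_insert v xs))) =
    [:real s, real (Suc n) - real s:] * monom 1 (exc_r s xs) + [:0, 1, -1:] * pderiv (monom 1 (exc_r s xs))"
proof -
  define D where "D = {i \<in> {1..length xs}. xs ! (i - 1) \<ge> i + s}"
  \<comment> \<open>The values of \<open>v\<close> that displace an excedance: the gain at the new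
    first position cancels the loss.\<close>
  define T where "T = (\<lambda>i. Suc (xs ! (i - 1))) ` D"
  define e where "e = exc_r s xs"
  have e: "e = card D"
    by (simp add: e_def D_def exc_r_def)
  have fin: "finite D"
    by (simp add: D_def)
  have dist: "distinct xs"
    using xs by (simp add: injs_def)
  have inj: "inj_on (\<lambda>i. Suc (xs ! (i - 1))) D"
    using dist by (auto simp: inj_on_def D_def nth_eq_iff_index_eq)
  have "xs ! (i - 1) \<le> n" if "i \<in> D" for i
  proof -
    have "xs ! (i - 1) \<in> set xs"
      using that by (auto simp: D_def)
    then show ?thesis
      using xs by (auto simp: injs_def)
  qed
  then have T_sub: "T \<subseteq> {Suc s..Suc n}"
    by (force simp: T_def D_def)
  have cT: "card T = e"
    using inj by (simp add: T_def card_image e)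
  have fT: "finite T"
    using fin by (simp add: T_def)
  have exc: "exc_r s (inj_insert v xs) = (if v > s then 1 else 0) + (e - (if v \<in> T then 1 else 0))" for v
  proof -
    have "{i \<in> {1..length xs}. xs ! (i - 1) \<ge> i + s \<and> Suc (xs ! (i - 1)) \<noteq> v}
        = D - {i \<in> D. Suc (xs ! (i - 1)) = v}"
      by (auto simp: D_def)
    moreover have "card {i \<in> D. Suc (xs ! (i - 1)) = v} = (if v \<in> T then 1 else 0)"
    proof (cases "v \<in> T")
      case True
      then obtain i where "i \<in> D" "v = Suc (xs ! (i - 1))"
        by (auto simp: T_def)
      then have "{i \<in> D. Suc (xs ! (i - 1)) = v} = {i}"
        using inj by (auto simp: inj_on_def)
      then show ?thesis
        using True by simp
    next
      case False
      then have "{i \<in> D. Suc (xs ! (i - 1)) = v} = {}"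
        by (auto simp: T_def)
      then show ?thesis
        using False by (simp only: card.empty if_False)
    qed
    ultimately show ?thesis
      using fin by (simp add: exc_r_inj_insert card_Diff_subset e)
  qed
  have split: "{1..Suc n} = T \<union> ({1..s} \<union> ({Suc s..Suc n} - T))"
    using T_sub s by auto
  have "e \<ge> 1" if "v \<in> T" for v
    using that cT fT card_gt_0_iff[of T] by auto
  then have T_sum: "(\<Sum>v\<in>T. monom (1::real) (exc_r s (inj_insert v xs))) = of_nat e * monom 1 e"
    using T_sub cT by (subst sum.cong[of T T _ "\<lambda>_. monom 1 e"]) (auto simp: exc)
  have s_sum: "(\<Sum>v\<in>{1..s}. monom (1::real) (exc_r s (inj_insert v xs))) = of_nat s * monom 1 e"
    using T_sub by (subst sum.cong[of "{1..s}" "{1..s}" _ "\<lambda>_. monom 1 e"]) (auto simp: exc)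
  have "e \<le> Suc n - s"
    using card_mono[OF _ T_sub] cT by simp
  have "card ({Suc s..Suc n} - T) = Suc n - s - e"
    using T_sub fT cT by (subst card_Diff_subset) auto
  then have o_sum: "(\<Sum>v\<in>{Suc s..Suc n} - T. monom (1::real) (exc_r s (inj_insert v xs)))
      = of_nat (Suc n - s - e) * monom 1 (Suc e)"
    by (subst sum.cong[of "{Suc s..Suc n} - T" "{Suc s..Suc n} - T" _ "\<lambda>_. monom 1 (Suc e)"]) (auto simp: exc)
  have "(\<Sum>v\<in>{1..Suc n}. monom (1::real) (exc_r s (inj_insert v xs))) =
      of_nat e * monom 1 e + (of_nat s * monom 1 e + of_nat (Suc n - s - e) * monom 1 (Suc e))"
    unfolding split
    by (subst sum.union_disjoint, use T_sub fT in \<open>auto\<close>)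
       (subst sum.union_disjoint, use fT T_sum s_sum o_sum in \<open>auto\<close>)
  also have "\<dots> = [:real s, real (Suc n) - real s:] * monom 1 e + [:0, 1, -1:] * pderiv (monom 1 e)"
  proof (rule poly_ext)
    fix x :: real
    have "real (Suc n - s - e) = real (Suc n) - real s - real e"
      using s \<open>e \<le> Suc n - s\<close> by linarith
    then show "poly (of_nat e * monom 1 e + (of_nat s * monom 1 e + of_nat (Suc n - s - e) * monom 1 (Suc e))) x =
        poly ([:real s, real (Suc n) - real s:] * monom 1 e + [:0, 1, -1:] * pderiv (monom 1 e)) x"
      by (cases e) (simp_all add: poly_monom pderiv_monom algebra_simps)
  qed
  finally show ?thesis
    by (simp add: e_def)
qed

lemma inj_exc_poly_Suc:
  assumes "q \<le> n" "s \<le> Suc n"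
  shows "inj_exc_poly (Suc n) q s =
    [:real s, real (Suc n) - real s:] * inj_exc_poly n q s + [:0, 1, -1:] * pderiv (inj_exc_poly n q s)"
proof -
  have pderiv_sum: "pderiv (sum f A) = (\<Sum>a\<in>A. pderiv (f a))" for f :: "nat list \<Rightarrow> real poly" and A
    by (induction A rule: infinite_finite_induct) (auto simp: pderiv_add)
  have "inj_exc_poly (Suc n) q s = (\<Sum>(v, xs)\<in>{1..Suc n} \<times> injs n q. monom 1 (exc_r s (inj_insert v xs)))"
    unfolding inj_exc_poly_def
    by (subst sum.reindex_bij_betw[OF bij_betw_inj_insert[OF assms(1)], symmetric])
       (simp add: case_prod_unfold)
  also have "\<dots> = (\<Sum>xs\<in>injs n q. \<Sum>v\<in>{1..Suc n}. monom 1 (exc_r s (inj_insert v xs)))"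
    by (subst sum.cartesian_product[symmetric], rule sum.swap)
  also have "\<dots> = (\<Sum>xs\<in>injs n q. [:real s, real (Suc n) - real s:] * monom 1 (exc_r s xs)
      + [:0, 1, -1:] * pderiv (monom 1 (exc_r s xs)))"
    using assms by (intro sum.cong refl sum_exc_r_inj_insert)
  finally show ?thesis
    by (simp only: sum.distrib sum_distrib_left inj_exc_poly_def pderiv_sum)
qed

section \<open>Propagation of negative simple roots along the recurrence\<close>

lemma inj_exc_poly_neg_simple_roots:
  assumes "1 \<le> s" "s \<le> m" "q \<le> m" "has_neg_simple_roots k (inj_exc_poly m q s)" "k + s \<le> m"
  shows "has_neg_simple_roots (k + d) (inj_exc_poly (m + d) q s)"
proof (induction d)
  case (Suc d)
  \<comment> \<open>The bound \<open>k + s <= m\<close> makes the coefficient of t exceed the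
    current degree, as the root-adding step requires.\<close>
  have "has_neg_simple_roots (Suc (k + d)) ([:real s, real (Suc (m + d)) - real s:] * inj_exc_poly (m + d) q s
      + [:0, 1, -1:] * pderiv (inj_exc_poly (m + d) q s))"
    using assms by (intro has_neg_simple_roots_step Suc) auto
  then show ?case
    using assms by (simp add: inj_exc_poly_Suc)
qed (use assms in simp)

lemma has_neg_simple_roots_const: "c > 0 \<Longrightarrow> has_neg_simple_roots 0 [:c:]"
  by (auto simp: has_neg_simple_roots_def)

text \<open>The induction starts at n = r, where entries are at most r and never reach
  \<open>i + r\<close>, so the polynomial is a positive constant.\<close>

lemma A_poly_neg_simple_roots:
  assumes "1 \<le> r" "r \<le> n"
  shows "has_neg_simple_roots (n - r) (A_poly n r)"
proof -
  have "exc_r r xs = 0" if "xs \<in> injs r 0" for xs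
  proof -
    have "xs ! (i - 1) < i + r" if "i \<in> {1..length xs}" for i
    proof -
      have "xs ! (i - 1) \<in> set xs"
        using that by auto
      then show ?thesis
        using \<open>xs \<in> injs r 0\<close> that by (auto simp: injs_def)
    qed
    then have "{i \<in> {1..length xs}. xs ! (i - 1) \<ge> i + r} = {}"
      by fastforce
    then show ?thesis
      unfolding exc_r_def by (simp only: card.empty)
  qed
  then have "inj_exc_poly r 0 r = [:real (card (injs r 0)):]"
    by (simp add: inj_exc_poly_def monom_0 of_nat_poly)
  moreover have "[1..<Suc r] \<in> injs r 0"
    by (auto simp: injs_def)
  then have "card (injs r 0) > 0"
    by (auto simp: card_gt_0_iff)
  ultimately have "has_neg_simple_roots 0 (inj_exc_poly r 0 r)"
    by (simp add: has_neg_simple_roots_const)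
  then show ?thesis
    using inj_exc_poly_neg_simple_roots[of r r 0 0 "n - r"] assms by (simp add: A_poly_eq)
qed

lemma inj_exc_poly_self: "inj_exc_poly r r s = 1"
proof -
  have "injs r r = {[]}"
    by (auto simp: injs_def)
  then show ?thesis
    by (simp add: inj_exc_poly_def exc_r_def)
qed

lemma J_poly_neg_simple_roots:
  assumes "1 \<le> r" "r \<le> n"
  shows "has_neg_simple_roots (n - r) (J_poly n r)"
proof -
  have "has_neg_simple_roots 0 (inj_exc_poly r r 1)"
    using has_neg_simple_roots_const[of 1] by (simp add: inj_exc_poly_self one_pCons)
  then show ?thesis
    using inj_exc_poly_neg_simple_roots[of 1 r r 0 "n - r"] assms by (simp add: J_poly_eq)
qed

section \<open>Lagrange inversion and generating functions\<close>

text \<open>Strong induction: with l = n - k, the coefficient of \<open>H ^ k\<close> at n is that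
  of \<open>E ^ k oo H\<close> at l, which involves only coefficients of powers of \<open>H\<close>
  at l. Integer factors stay on both sides because the coefficient ring, later the power series in
  t, is not a field.\<close>

lemma lagrange_inversion_power:
  fixes E H :: "'a :: {idom, semiring_char_0} fps"
  assumes H: "H = fps_X * (E oo H)" and kn: "k \<le> n"
  shows "of_nat n * (H ^ k) $ n = of_nat k * (E ^ n) $ (n - k)"
  using kn
proof (induction n arbitrary: k rule: less_induct)
  case (less n)
  have H0: "H $ 0 = 0"
    by (subst H) simp
  have "H ^ k = fps_X ^ k * (E ^ k oo H)"
    by (subst H) (simp add: power_mult_distrib fps_compose_power[OF H0])
  then have Hk: "(H ^ k) $ n = (E ^ k oo H) $ (n - k)"
    using less.prems by (simp add: fps_X_power_mult_nth)
  consider "k = n" | "k = 0" "k < n" | "0 < k" "k < n"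
    using less.prems by linarith
  then show ?case
  proof cases
    case 1
    then show ?thesis
      using Hk by simp
  next
    case 2
    then show ?thesis
      by simp
  next
    case 3
    define l where "l = n - k"
    have l: "0 < l" "l < n" "n = k + l"
      using 3 by (auto simp: l_def)
    have "of_nat l * (E ^ k oo H) $ l = (\<Sum>j=0..l. (E ^ k) $ j * (of_nat l * (H ^ j) $ l))"
      by (simp add: fps_compose_nth sum_distrib_left mult_ac)
    also have "\<dots> = (\<Sum>j=0..l. (E ^ k) $ j * (of_nat j * (E ^ l) $ (l - j)))"
      using less.IH[OF l(2)] by (intro sum.cong refl) simp
    also have "\<dots> = (fps_X * fps_deriv (E ^ k) * E ^ l) $ l"
      unfolding fps_mult_nth[of "fps_X * fps_deriv (E ^ k)"]
      by (intro sum.cong refl) (auto simp: mult_ac)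
    finally have "of_nat n * (of_nat l * (H ^ k) $ n)
        = (of_nat n * (fps_X * fps_deriv (E ^ k) * E ^ l)) $ l"
      using Hk by (simp add: l_def fps_of_nat[symmetric])
    \<comment> \<open>Both sides equal n k X E' E^(n-1), since n = k + l.\<close>
    also have "of_nat n * (fps_X * fps_deriv (E ^ k) * E ^ l) = of_nat k * (fps_X * fps_deriv (E ^ n))"
    proof -
      have "E ^ (n - 1) = E ^ (k - 1) * E ^ l"
        using 3 l by (simp flip: power_add)
      then show ?thesis
        by (simp add: fps_deriv_power' mult_ac)
    qed
    also have "(of_nat k * (fps_X * fps_deriv (E ^ n))) $ l = of_nat k * (of_nat l * (E ^ n) $ l)"
      using l by (simp add: fps_of_nat[symmetric])
    finally have "of_nat l * (of_nat n * (H ^ k) $ n) = of_nat l * (of_nat k * (E ^ n) $ l)"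
      by (simp add: mult_ac)
    moreover have "of_nat l \<noteq> (0 :: 'a)"
      using l(1) by simp
    ultimately show ?thesis
      unfolding l_def by (metis mult_left_cancel)
  qed
qed

text \<open>The series H = X P satisfies H = X (E oo H), and its coefficient at n + 1 is that of P
  at n.\<close>

lemma lagrange_inversion:
  fixes E P :: "'a :: {idom, semiring_char_0} fps"
  assumes "P = E oo (fps_X * P)"
  shows "of_nat (Suc n) * P $ n = (E ^ Suc n) $ n"
  using lagrange_inversion_power[of "fps_X * P" E 1 "Suc n"] assms by simp

section \<open>Series expansions for the Eulerian polynomials and \<open>J_poly\<close>\<close>

lemma fps_one_minus_X_mult_nth:
  fixes f :: "'a :: comm_ring_1 fps"
  shows "((1 - fps_X) * f) $ n = f $ n - (if n = 0 then 0 else f $ (n - 1))"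
  by (simp add: left_diff_distrib)

lemma sum_choose_add: "(\<Sum>a\<le>m. (m - a + j) choose j) = (m + Suc j) choose Suc j"
proof -
  have "(\<Sum>a\<le>m. (m - a + j) choose j) = (\<Sum>a\<le>m. (a + j) choose j)"
    by (rule sum.reindex_bij_witness[of _ "\<lambda>a. m - a" "\<lambda>a. m - a"]) auto
  also have "\<dots> = (m + Suc j) choose Suc j"
    by (induction m) simp_all
  finally show ?thesis .
qed

text \<open>The outer variable z marks the size and the inner variable t the descents. The inner
  series are Eulerian polynomials in the form (1 - t)^(k+1) times the sum of m^k t^m; in closed form
  this is (1 - t) / (1 - t e^((1-t)z)).\<close>

definition eulerian_egf :: "real fps fps" where
  "eulerian_egf = Abs_fps (\<lambda>k. fps_const (1 / fact k) * (1 - fps_X) ^ Suc k * Abs_fps (\<lambda>m. of_nat m ^ k))"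

text \<open>This is the negative binomial expansion of a power of the closed form, proved by
  multiplying in one factor at a time.\<close>

lemma eulerian_egf_power:
  "(eulerian_egf ^ Suc j) $ k = fps_const (1 / fact k) * (1 - fps_X) ^ (k + Suc j) *
     Abs_fps (\<lambda>m. of_nat ((m + j) choose j) * of_nat m ^ k)"
proof (induction j arbitrary: k)
  case 0
  then show ?case
    by (simp add: eulerian_egf_def)
next
  case (Suc j)
  let ?F = "\<lambda>i. Abs_fps (\<lambda>m. of_nat m ^ i) :: real fps"
  let ?G = "\<lambda>i. Abs_fps (\<lambda>m. of_nat ((m + j) choose j) * of_nat m ^ i) :: real fps"
  let ?c = "\<lambda>i. fps_const (1 / fact i) :: real fps"
  have "(eulerian_egf ^ Suc (Suc j)) $ k = (\<Sum>i=0..k. eulerian_egf $ i * (eulerian_egf ^ Suc j) $ (k - i))"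
    by (simp only: power_Suc[of _ "Suc j"] fps_mult_nth)
  also have "\<dots> = (\<Sum>i=0..k. (1 - fps_X) ^ (k + Suc (Suc j)) * (?c i * ?c (k - i) * (?F i * ?G (k - i))))"
  proof (intro sum.cong refl)
    fix i assume "i \<in> {0..k}"
    then have "(1 - fps_X :: real fps) ^ (k + Suc (Suc j)) = (1 - fps_X) ^ Suc i * (1 - fps_X) ^ (k - i + Suc j)"
      by (simp only: power_add[symmetric]) simp
    then show "eulerian_egf $ i * (eulerian_egf ^ Suc j) $ (k - i)
        = (1 - fps_X) ^ (k + Suc (Suc j)) * (?c i * ?c (k - i) * (?F i * ?G (k - i)))"
      unfolding Suc.IH by (simp only: eulerian_egf_def fps_nth_Abs_fps mult_ac)
  qed
  also have "\<dots> = (1 - fps_X) ^ (k + Suc (Suc j)) * (\<Sum>i=0..k. ?c i * ?c (k - i) * (?F i * ?G (k - i)))"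
    by (simp only: sum_distrib_left)
  also have "(\<Sum>i=0..k. ?c i * ?c (k - i) * (?F i * ?G (k - i)))
      = ?c k * Abs_fps (\<lambda>m. of_nat ((m + Suc j) choose Suc j) * of_nat m ^ k)"
  proof (rule fps_ext)
    fix m
    have "(\<Sum>i=0..k. ?c i * ?c (k - i) * (?F i * ?G (k - i))) $ m
        = (\<Sum>i=0..k. \<Sum>a=0..m. 1 / (fact i * fact (k - i)) *
            (real a ^ i * (real ((m - a + j) choose j) * real (m - a) ^ (k - i))))"
      by (simp add: fps_sum_nth fps_mult_nth[of "Abs_fps _"] sum_distrib_left mult.assoc)
    \<comment> \<open>After the swap the inner sum is the binomial expansion of (a + (m - a))^k =
      m^k, and a hockey-stick sum over a remains.\<close>
    also have "\<dots> = (\<Sum>a=0..m. \<Sum>i=0..k. 1 / fact k * real ((m - a + j) choose j) *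
            (real (k choose i) * real a ^ i * real (m - a) ^ (k - i)))"
      by (subst sum.swap, intro sum.cong refl) (auto simp: binomial_fact field_simps)
    also have "\<dots> = (\<Sum>a=0..m. 1 / fact k * real ((m - a + j) choose j) * (real a + real (m - a)) ^ k)"
      by (simp only: binomial_ring sum_distrib_left atLeast0AtMost)
    also have "\<dots> = (\<Sum>a=0..m. (1 / fact k * real m ^ k) * real ((m - a + j) choose j))"
      by (intro sum.cong refl) (simp add: of_nat_diff)
    also have "\<dots> = 1 / fact k * real m ^ k * real ((m + Suc j) choose Suc j)"
      unfolding sum_choose_add[symmetric] of_nat_sum sum_distrib_left atLeast0AtMost ..
    finally show "(\<Sum>i=0..k. ?c i * ?c (k - i) * (?F i * ?G (k - i))) $ m
        = (?c k * Abs_fps (\<lambda>m. of_nat ((m + Suc j) choose Suc j) * of_nat m ^ k)) $ m"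
      by (simp add: mult_ac)
  qed
  finally show ?case
    by (simp only: mult_ac)
qed

text \<open>By Pascal's rule each factor 1 - t lowers the binomial by one level. This is the case of
  \<open>fps_J_poly\<close> in which \<open>J_poly\<close> is 1.\<close>

lemma fps_one_minus_X_power_mult_binomial:
  "(1 - fps_X) ^ Suc (Suc r) * Abs_fps (\<lambda>m. of_nat ((m + r) choose Suc r)) = (fps_X :: real fps)"
proof (induction r)
  case 0
  have "((1 - fps_X) * ((1 - fps_X) * Abs_fps (\<lambda>m. of_nat m))) $ n = (fps_X :: real fps) $ n" for n
    by (simp only: fps_one_minus_X_mult_nth) (auto simp: fps_X_def of_nat_diff)
  then show ?case
    by (simp add: fps_eq_iff mult.assoc)
next
  case (Suc r)
  have "(1 - fps_X) * Abs_fps (\<lambda>m. of_nat ((m + Suc r) choose Suc (Suc r))) =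
      (Abs_fps (\<lambda>m. of_nat ((m + r) choose Suc r)) :: real fps)" (is "?l = ?r")
  proof (rule fps_ext)
    fix n
    show "?l $ n = ?r $ n"
      unfolding fps_one_minus_X_mult_nth by (cases n) (simp_all add: binomial_eq_0)
  qed
  then show ?case
    using Suc by (simp only: power_Suc2[of _ "Suc (Suc r)"] mult.assoc)
qed

text \<open>After division by the power of 1 - t, the recurrence for \<open>J_poly\<close> becomes
  the operator t d/dt, which multiplies the coefficient at m by m.\<close>

lemma fps_J_poly:
  "fps_X * fps_of_poly (J_poly (Suc r + d) (Suc r)) = (1 - fps_X) ^ Suc (Suc r + d) *
     Abs_fps (\<lambda>m. of_nat m ^ d * of_nat ((m + r) choose Suc r))"
proof (induction d)
  case 0
  then show ?case
    by (simp add: J_poly_eq inj_exc_poly_self fps_one_minus_X_power_mult_binomial del: power_Suc)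
next
  case (Suc d)
  define n where "n = Suc r + d"
  define f where "f = fps_of_poly (J_poly n (Suc r))"
  define S :: "nat \<Rightarrow> real fps" where "S d = Abs_fps (\<lambda>m. of_nat m ^ d * of_nat ((m + r) choose Suc r))" for d
  have IH: "fps_X * f = (1 - fps_X) ^ Suc n * S d"
    using Suc.IH by (simp only: f_def n_def S_def)
  have S: "fps_X * fps_deriv (S d) = S (Suc d)"
    by (rule fps_ext) (simp add: S_def)
  have "J_poly (Suc n) (Suc r) = [:1, real n:] * J_poly n (Suc r) + [:0, 1, -1:] * pderiv (J_poly n (Suc r))"
    unfolding J_poly_eq by (subst inj_exc_poly_Suc) (simp_all add: n_def)
  moreover have coeffs: "fps_of_poly [:1, real n:] = 1 + of_nat n * fps_X"
    "fps_of_poly [:0, 1, -1 :: real:] = fps_X * (1 - fps_X)"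
    by (simp_all add: fps_of_poly_pCons fps_of_nat algebra_simps flip: fps_const_neg)
  ultimately have new: "fps_of_poly (J_poly (Suc n) (Suc r)) = (1 + of_nat n * fps_X) * f + fps_X * (1 - fps_X) * fps_deriv f"
    by (simp only: f_def fps_of_poly_add fps_of_poly_mult fps_of_poly_pderiv coeffs)
  have "fps_deriv (fps_X * f) = fps_deriv ((1 - fps_X) ^ Suc n * S d)"
    by (simp only: IH)
  \<comment> \<open>The derivative of the induction hypothesis, solved for t f'.\<close>
  then have D: "fps_X * fps_deriv f = (1 - fps_X) ^ Suc n * fps_deriv (S d) - of_nat (Suc n) * (1 - fps_X) ^ n * S d - f"
    by (simp add: fps_deriv_power' algebra_simps del: power_Suc of_nat_Suc)
  have "fps_X * fps_of_poly (J_poly (Suc n) (Suc r))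
      = (1 + of_nat n * fps_X) * (fps_X * f) + fps_X * ((1 - fps_X) * (fps_X * fps_deriv f))"
    unfolding new by (simp add: algebra_simps)
  also have "\<dots> = (of_nat (Suc n) * fps_X) * (fps_X * f) - of_nat (Suc n) * fps_X * ((1 - fps_X) ^ Suc n * S d)
      + (1 - fps_X) ^ Suc (Suc n) * (fps_X * fps_deriv (S d))"
    unfolding D by (simp add: algebra_simps)
  also have "\<dots> = (1 - fps_X) ^ Suc (Suc n) * S (Suc d)"
    unfolding IH S by simp
  finally show ?case
    by (simp only: n_def S_def add_Suc_right)
qed

section \<open>Quasi-Stirling words\<close>

text \<open>An arbitrary alphabet \<open>S\<close> is allowed because the pieces of a word use only
  some of its letters. The case \<open>x = y\<close> excludes nothing, as each letter occurs just
  twice.\<close>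

definition qs_words :: "nat set \<Rightarrow> nat list set" where
  "qs_words S = {w. set w = S \<and> (\<forall>x\<in>S. count_list w x = 2) \<and> (\<forall>x y. \<not> subseq [x, y, x, y] w)}"

lemma subseq4_iff_nth:
  "subseq [a, b, c, d] xs \<longleftrightarrow> (\<exists>i j k l. i < j \<and> j < k \<and> k < l \<and> l < length xs \<and>
     xs ! i = a \<and> xs ! j = b \<and> xs ! k = c \<and> xs ! l = d)" (is "?L \<longleftrightarrow> ?R")
proof
  assume ?L
  then obtain p u where u: "xs = p @ a # u" "subseq [b, c, d] u"
    using list_emb_ConsD[of "(=)" a "[b, c, d]" xs] by auto
  then obtain q v where v: "u = q @ b # v" "subseq [c, d] v"
    using list_emb_ConsD[of "(=)" b "[c, d]" u] by auto
  then obtain r w where w: "v = r @ c # w" "subseq [d] w"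
    using list_emb_ConsD[of "(=)" c "[d]" v] by auto
  then obtain s z where z: "w = s @ d # z"
    using list_emb_ConsD[of "(=)" d "[]" w] by auto
  let ?i = "length p"
  let ?j = "?i + Suc (length q)"
  let ?k = "?j + Suc (length r)"
  let ?l = "?k + Suc (length s)"
  have "?i < ?j \<and> ?j < ?k \<and> ?k < ?l \<and> ?l < length xs \<and> xs ! ?i = a \<and> xs ! ?j = b \<and> xs ! ?k = c \<and> xs ! ?l = d"
    unfolding u(1) v(1) w(1) z by (simp add: nth_append)
  then show ?R
    by blast
next
  have drop_sub: "subseq (xs ! i # ys) (drop m xs)" if "m \<le> i" "i < length xs" "subseq ys (drop (Suc i) xs)" for m i ys
  proof -
    have "drop m xs = drop m (take i xs) @ xs ! i # drop (Suc i) xs"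
      using that(1,2) by (metis drop_append append_take_drop_id Cons_nth_drop_Suc diff_is_0_eq
          drop0 length_take min.absorb4)
    then show ?thesis
      using that(3) by auto
  qed
  assume ?R
  then obtain i j k l where *: "i < j" "j < k" "k < l" "l < length xs"
    "xs ! i = a" "xs ! j = b" "xs ! k = c" "xs ! l = d"
    by blast
  have "subseq [d] (drop (Suc k) xs)"
    using drop_sub[of "Suc k" l "[]"] * by simp
  then have "subseq [c, d] (drop (Suc j) xs)"
    using drop_sub[of "Suc j" k "[d]"] * by simp
  then have "subseq [b, c, d] (drop (Suc i) xs)"
    using drop_sub[of "Suc i" j "[c, d]"] * by simp
  then show ?L
    using drop_sub[of 0 i "[b, c, d]"] * by simp
qed

lemma quasi_stirling_eq_qs_words: "quasi_stirling n = qs_words {1..n}"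
proof -
  have mset: "mset xs = mset ([1..<n + 1] @ [1..<n + 1]) \<longleftrightarrow> set xs = {1..n} \<and> (\<forall>x\<in>{1..n}. count_list xs x = 2)"
    (is "?L xs \<longleftrightarrow> ?R xs") for xs
  proof -
    have one: "count_list [1..<n + 1] x = (if x \<in> {1..n} then 1 else 0)" for x
      unfolding count_mset[symmetric] mset_upt by (simp add: count_mset_set')
    have "?L xs \<longleftrightarrow> (\<forall>x. count_list xs x = (if x \<in> {1..n} then 2 else 0))"
      unfolding multiset_eq_iff count_mset count_list_append one by (auto simp: numeral_2_eq_2)
    also have "\<dots> \<longleftrightarrow> ?R xs"
      using count_list_0_iff[of xs] by (auto split: if_splits)
    finally show ?thesis .
  qed
  have crossing: "(\<exists>i j k l. i < j \<and> j < k \<and> k < l \<and> l < length xs \<and> xs ! i = xs ! k \<and> xs ! j = xs ! l)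
      \<longleftrightarrow> (\<exists>x y. subseq [x, y, x, y] xs)" (is "?L xs \<longleftrightarrow> ?R xs") for xs
  proof
    assume "?L xs"
    then obtain i j k l where "i < j" "j < k" "k < l" "l < length xs" "xs ! i = xs ! k" "xs ! j = xs ! l"
      by blast
    then have "subseq [xs ! i, xs ! j, xs ! i, xs ! j] xs"
      unfolding subseq4_iff_nth by (intro exI[of _ i] exI[of _ j] exI[of _ k] exI[of _ l]) simp
    then show "?R xs"
      by blast
  next
    assume "?R xs"
    then obtain x y i j k l where "i < j" "j < k" "k < l" "l < length xs"
      "xs ! i = x" "xs ! j = y" "xs ! k = x" "xs ! l = y"
      unfolding subseq4_iff_nth by blast
    then show "?L xs"
      by (intro exI[of _ i] exI[of _ j] exI[of _ k] exI[of _ l]) simp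
  qed
  show ?thesis
    unfolding quasi_stirling_def qs_words_def mset crossing by auto
qed

lemma subseq_set_subset: "subseq xs ys \<Longrightarrow> set xs \<subseteq> set ys"
  by (induction rule: list_emb.induct) auto

text \<open>Cut a crossing before the second \<open>c\<close>. A letter on both sides of the cut
  must be \<open>c\<close>, which occurs only at the head of each side; a crossing within one side
  would lie in \<open>u\<close> or \<open>v\<close>.\<close>

lemma qs_words_Cons:
  assumes "c \<in> S" "U \<subseteq> S - {c}" "u \<in> qs_words U" "v \<in> qs_words (S - {c} - U)"
  shows "c # u @ c # v \<in> qs_words S"
proof -
  define V where "V = S - {c} - U"
  have u: "set u = U" "\<And>x. x \<in> U \<Longrightarrow> count_list u x = 2" "\<And>x y. \<not> subseq [x, y, x, y] u"
    and v: "set v = V" "\<And>x. x \<in> V \<Longrightarrow> count_list v x = 2" "\<And>x y. \<not> subseq [x, y, x, y] v"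
    using assms(3,4) by (auto simp: qs_words_def V_def)
  have c: "c \<notin> U" "c \<notin> V" "U \<inter> V = {}" "S = insert c (U \<union> V)"
    using assms(1,2) by (auto simp: V_def)
  have "\<not> subseq [x, y, x, y] (c # u @ c # v)" for x y
  proof
    assume "subseq [x, y, x, y] (c # u @ c # v)"
    then obtain A B where AB: "[x, y, x, y] = A @ B" "subseq A (c # u)" "subseq B (c # v)"
      using subseq_append_iff[of "[x, y, x, y]" "c # u" "c # v"] by auto
    have A: "set A \<subseteq> insert c U" and B: "set B \<subseteq> insert c V"
      using subseq_set_subset[OF AB(2)] subseq_set_subset[OF AB(3)] u(1) v(1) by auto
    have not_u: "c \<notin> set zs" if "subseq zs u" for zs
      using subseq_set_subset[OF that] u(1) c(1) by auto
    have not_v: "c \<notin> set zs" if "subseq zs v" for zs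
      using subseq_set_subset[OF that] v(1) c(2) by auto
    have "A = [] \<and> B = [x, y, x, y] \<or> A = [x] \<and> B = [y, x, y] \<or> A = [x, y] \<and> B = [x, y]
        \<or> A = [x, y, x] \<and> B = [y] \<or> A = [x, y, x, y] \<and> B = []"
      using AB(1) by (auto simp: Cons_eq_append_conv)
    then show False
    proof (elim disjE conjE)
      assume "A = []" "B = [x, y, x, y]"
      then show False
        using AB(3) not_v[of "[y, x, y]"] v(3)[of x y] by (auto split: if_splits)
    next
      assume "A = [x]" "B = [y, x, y]"
      then show False
        using AB(3) not_v[of "[x, y]"] subseq_set_subset[of "[y, x, y]" v] A c v(1)
        by (auto split: if_splits)
    next
      assume "A = [x, y]" "B = [x, y]"
      then have "x = c" "y = c"
        using A B c(3) by auto
      then show False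
        using AB(2) \<open>A = [x, y]\<close> not_u[of "[c]"] by auto
    next
      assume "A = [x, y, x]" "B = [y]"
      then have "y = c"
        using A B c(3) by auto
      then show False
        using AB(2) \<open>A = [x, y, x]\<close> not_u[of "[c, x]"] not_u[of "[x, c, x]"] by (auto split: if_splits)
    next
      assume "A = [x, y, x, y]" "B = []"
      then show False
        using AB(2) not_u[of "[y, x, y]"] u(3)[of x y] by (auto split: if_splits)
    qed
  qed
  moreover have "count_list (c # u @ c # v) x = 2" if "x \<in> S" for x
    using that c u(1,2) v(1,2) by (auto simp: disjoint_iff)
  ultimately show ?thesis
    using c u(1) v(1) by (auto simp: qs_words_def)
qed

text \<open>Cut at the second occurrence of the first letter \<open>c\<close>: a letter
  \<open>x\<close> both inside and after it would form the crossing c x c x.\<close>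

lemma qs_words_decompose:
  assumes "w \<in> qs_words S" "S \<noteq> {}"
  obtains c u v where "c \<in> S" "set u \<subseteq> S - {c}" "u \<in> qs_words (set u)"
    "v \<in> qs_words (S - {c} - set u)" "w = c # u @ c # v"
proof -
  have w: "set w = S" "\<And>x. x \<in> S \<Longrightarrow> count_list w x = 2" "\<And>x y. \<not> subseq [x, y, x, y] w"
    using assms(1) by (auto simp: qs_words_def)
  obtain c w' where w': "w = c # w'"
    using w(1) assms(2) by (cases w) auto
  have c: "c \<in> S"
    using w(1) w' by auto
  have "count_list w' c = Suc 0"
    using w(2)[OF c] w' by simp
  then obtain u v where uv: "w' = u @ c # v" "c \<notin> set u" "count_list v c = 0"
    using count_list_Suc_split_first by metis
  have "c \<notin> set v"
    using uv(3) by (simp add: count_list_0_iff)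
  have w_eq: "w = c # u @ c # v"
    using w' uv(1) by simp
  have disj: "x \<notin> set v" if "x \<in> set u" for x
  proof
    assume "x \<in> set v"
    have "subseq ([c] @ [x] @ [c] @ [x]) ([c] @ u @ [c] @ v)"
      using that \<open>x \<in> set v\<close> by (intro list_emb_append_mono) (simp_all add: subseq_singleton_left)
    then show False
      using w(3)[of c x] by (simp add: w_eq)
  qed
  have sub: "subseq u w" "subseq v w"
    unfolding w_eq by (auto intro: list_emb_append2 subseq_rev_drop_many)
  have "\<not> subseq [x, y, x, y] u" "\<not> subseq [x, y, x, y] v" for x y
    using w(3) sub subseq_order.order_trans by blast+
  moreover have "count_list u x = 2" if "x \<in> set u" for x
  proof -
    have "count_list v x = 0" "x \<noteq> c" "x \<in> S"
      using that disj uv(2) w(1) w_eq by (auto simp: count_list_0_iff)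
    then show ?thesis
      using w(2)[of x] w_eq by simp
  qed
  moreover have "count_list v x = 2" if "x \<in> set v" for x
  proof -
    have "count_list u x = 0" "x \<noteq> c" "x \<in> S"
      using that disj \<open>c \<notin> set v\<close> w(1) w_eq by (auto simp: count_list_0_iff)
    then show ?thesis
      using w(2)[of x] w_eq by simp
  qed
  moreover have "set v = S - {c} - set u" "set u \<subseteq> S - {c}"
    using w(1) w_eq uv(2) \<open>c \<notin> set v\<close> disj by auto
  ultimately show thesis
    using c w_eq by (intro that[of c u v]) (auto simp: qs_words_def)
qed

lemma qs_words_empty [simp]: "qs_words {} = {[]}"
  by (auto simp: qs_words_def)

lemma finite_qs_words [simp]:
  assumes "finite S"
  shows "finite (qs_words S)"
proof (rule finite_subset[OF _ finite_lists_length_eq[OF assms]])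
  show "qs_words S \<subseteq> {w. set w \<subseteq> S \<and> length w = 2 * card S}"
  proof safe
    fix w assume w: "w \<in> qs_words S"
    then have "length w = (\<Sum>x\<in>S. count_list w x)"
      using sum_count_set[of w S] assms by (simp add: qs_words_def)
    also have "\<dots> = (\<Sum>x\<in>S. 2)"
      using w by (intro sum.cong) (auto simp: qs_words_def)
    finally show "length w = 2 * card S"
      by simp
  qed (auto simp: qs_words_def)
qed

text \<open>The cut is unique, since \<open>c\<close> occurs in neither \<open>u\<close> nor
  \<open>v\<close>, and \<open>U\<close> is recovered as the letters of \<open>u\<close>.\<close>

lemma sum_qs_words:
  fixes F :: "nat list \<Rightarrow> 'a :: comm_monoid_add"
  assumes S: "finite S" "S \<noteq> {}"
  shows "(\<Sum>w\<in>qs_words S. F w) =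
    (\<Sum>c\<in>S. \<Sum>U\<in>Pow (S - {c}). \<Sum>u\<in>qs_words U. \<Sum>v\<in>qs_words (S - {c} - U). F (c # u @ c # v))"
proof -
  let ?D = "SIGMA c:S. SIGMA U:Pow (S - {c}). qs_words U \<times> qs_words (S - {c} - U)"
  let ?f = "\<lambda>(c, U, u, v). c # u @ c # v"
  have fin: "finite (qs_words U)" if "U \<subseteq> S" for U
    using that S(1) by (simp add: finite_subset)
  have inj: "inj_on ?f ?D"
  proof (rule inj_onI)
    fix p p' assume p: "p \<in> ?D" "p' \<in> ?D" "?f p = ?f p'"
    obtain c U u v where pq: "p = (c, U, u, v)"
      by (cases p)
    obtain c' U' u' v' where pq': "p' = (c', U', u', v')"
      by (cases p')
    have U: "U \<subseteq> S - {c}" "U' \<subseteq> S - {c'}"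
      and words: "u \<in> qs_words U" "v \<in> qs_words (S - {c} - U)" "u' \<in> qs_words U'" "v' \<in> qs_words (S - {c'} - U')"
      and eq: "c # u @ c # v = c' # u' @ c' # v'"
      using p pq pq' by auto
    have sets: "set u = U" "set v = S - {c} - U" "set u' = U'"
      using words by (auto simp: qs_words_def)
    have "c = c'"
      using eq by simp
    moreover have "c \<notin> set u" "c \<notin> set v"
      using sets U by auto
    ultimately have "u = u'" "v = v'"
      using eq append_Cons_eq_iff[of c u v u' v'] by auto
    then show "p = p'"
      using sets \<open>c = c'\<close> pq pq' by simp
  qed
  have "?f ` ?D = qs_words S"
  proof (rule set_eqI, rule iffI)
    fix w assume "w \<in> ?f ` ?D"
    then show "w \<in> qs_words S"
      using qs_words_Cons by auto
  next
    fix w assume "w \<in> qs_words S"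
    then obtain c u v where "c \<in> S" "set u \<subseteq> S - {c}" "u \<in> qs_words (set u)"
      "v \<in> qs_words (S - {c} - set u)" "w = c # u @ c # v"
      using qs_words_decompose S(2) by blast
    then show "w \<in> ?f ` ?D"
      by (intro image_eqI[of _ _ "(c, set u, u, v)"]) auto
  qed
  then have "(\<Sum>w\<in>qs_words S. F w) = (\<Sum>(c, U, u, v)\<in>?D. F (c # u @ c # v))"
    using sum.reindex[OF inj, of F] by (simp add: case_prod_unfold comp_def)
  also have "\<dots> = (\<Sum>c\<in>S. \<Sum>(U, u, v)\<in>(SIGMA U:Pow (S - {c}). qs_words U \<times> qs_words (S - {c} - U)). F (c # u @ c # v))"
    using S fin by (subst sum.Sigma) (auto intro!: finite_SigmaI)
  also have "\<dots> = (\<Sum>c\<in>S. \<Sum>U\<in>Pow (S - {c}). \<Sum>(u, v)\<in>qs_words U \<times> qs_words (S - {c} - U). F (c # u @ c # v))"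
    using S fin by (intro sum.cong refl, subst sum.Sigma) (auto intro!: finite_SigmaI)
  finally show ?thesis
    by (simp only: sum.cartesian_product)
qed

section \<open>Descents of words framed by two boundary letters\<close>

fun path_des :: "nat \<Rightarrow> nat list \<Rightarrow> nat \<Rightarrow> nat" where
  "path_des a [] b = (if a > b then 1 else 0)"
| "path_des a (x # xs) b = (if a > x then 1 else 0) + path_des x xs b"

lemma path_des_append: "path_des a (xs @ c # ys) b = path_des a xs c + path_des c ys b"
  by (induction xs arbitrary: a) simp_all

lemma des_Cons_Cons: "des (x # y # ys) = (if x > y then 1 else 0) + des (y # ys)"
proof -
  let ?E = "{i \<in> {1..length (y # ys)}. i = length (y # ys) \<or> (y # ys) ! (i - 1) > (y # ys) ! i}"
  have "{i \<in> {1..length (x # y # ys)}. i = length (x # y # ys) \<or> (x # y # ys) ! (i - 1) > (x # y # ys) ! i}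
      = (if x > y then {1} else {}) \<union> Suc ` ?E" (is "?L = ?R")
  proof (rule set_eqI)
    fix i
    show "i \<in> ?L \<longleftrightarrow> i \<in> ?R"
    proof (cases i)
      case (Suc j)
      then show ?thesis
        by (cases j) (auto simp: image_iff)
    qed auto
  qed
  moreover have "card (Suc ` ?E) = card ?E"
    by (simp add: card_image)
  moreover have "1 \<notin> Suc ` ?E"
    by auto
  ultimately show ?thesis
    unfolding des_def by (simp add: card_insert_if)
qed

text \<open>A frame of zeros below all letters adds no descent at the start and one at the end of a
  nonempty word, which is the convention that the last position is a descent.\<close>

lemma path_des_eq_des:
  assumes "0 \<notin> set xs"
  shows "path_des 0 xs 0 = des xs"
proof -
  have "path_des x xs 0 = des (x # xs)" if "0 \<notin> set (x # xs)" for x xs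
    using that
  proof (induction xs arbitrary: x)
    case Nil
    have "{i \<in> {1..length [x]}. i = length [x] \<or> [x] ! (i - 1) > [x] ! i} = {1}"
      by auto
    then show ?case
      using Nil by (simp add: des_def)
  qed (simp add: des_Cons_Cons)
  then show ?thesis
    using assms by (cases xs) (simp_all add: des_def)
qed

section \<open>Descents of orderings of a set\<close>

text \<open>\<open>order_gf a b C\<close> is, with \<open>fps_X\<close> marking descents, the generating function of the words \<open>a w b\<close>
  where \<open>w\<close> is an ordering of \<open>C\<close>. Here \<open>bar_count\<close> counts the ways to insert \<open>m\<close> bars into such words
  covering all descents: each letter of \<open>C\<close> chooses one of the compartments \<open>0, \<dots>, m\<close>, where the
  first one only admits letters above \<open>a\<close> and the last one only letters below \<open>b\<close>.\<close>

definition bar_count :: "nat \<Rightarrow> nat \<Rightarrow> nat \<Rightarrow> nat set \<Rightarrow> real" where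
  "bar_count m a b C = (if m = 0 \<and> a > b then 0 else
     \<Prod>c\<in>C. real m - 1 + of_bool (c < b) + of_bool (a < c))"

definition order_gf :: "nat \<Rightarrow> nat \<Rightarrow> nat set \<Rightarrow> real fps" where
  "order_gf a b C = (1 - fps_X) ^ Suc (card C) * Abs_fps (\<lambda>m. bar_count m a b C)"

text \<open>A telescoping sum: raise the factors in the upper set \<open>R\<close> by one, from the
  largest down. Raising the one at \<open>c\<close> adds the product of the others, in which exactly
  those above \<open>c\<close> carry the increment.\<close>

lemma prod_add_upper_set:
  fixes y :: "nat \<Rightarrow> 'a :: comm_ring_1"
  assumes "finite C" and R: "\<And>c d. R c \<Longrightarrow> c < d \<Longrightarrow> R d"
  shows "(\<Sum>c | c \<in> C \<and> R c. \<Prod>d\<in>C - {c}. y d + of_bool (c < d)) =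
    (\<Prod>d\<in>C. y d + of_bool (R d)) - (\<Prod>d\<in>C. y d)"
  using assms(1)
proof (induction C rule: finite_linorder_max_induct)
  case (insert b C)
  have b: "b \<notin> C"
    using insert.hyps by auto
  show ?case
  proof (cases "R b")
    case False
    then have "\<not> R d" if "d \<in> insert b C" for d
      using that R insert.hyps by blast
    then show ?thesis
      by (auto intro!: sum.neutral)
  next
    case True
    have "{c. c \<in> insert b C \<and> R c} = insert b {c. c \<in> C \<and> R c}"
      using True by auto
    then have "(\<Sum>c | c \<in> insert b C \<and> R c. \<Prod>d\<in>insert b C - {c}. y d + of_bool (c < d)) =
        (\<Prod>d\<in>insert b C - {b}. y d + of_bool (b < d)) +
        (\<Sum>c | c \<in> C \<and> R c. \<Prod>d\<in>insert b C - {c}. y d + of_bool (c < d))"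
      using b insert.hyps(1) by simp
    also have "(\<Prod>d\<in>insert b C - {b}. y d + of_bool (b < d)) = (\<Prod>d\<in>C. y d)"
      using b insert.hyps(2) by (intro prod.cong) auto
    also have "(\<Sum>c | c \<in> C \<and> R c. \<Prod>d\<in>insert b C - {c}. y d + of_bool (c < d)) =
        (\<Sum>c | c \<in> C \<and> R c. (y b + 1) * (\<Prod>d\<in>C - {c}. y d + of_bool (c < d)))"
    proof (intro sum.cong refl)
      fix c assume c: "c \<in> {c. c \<in> C \<and> R c}"
      then have "insert b C - {c} = insert b (C - {c})"
        using b by auto
      then show "(\<Prod>d\<in>insert b C - {c}. y d + of_bool (c < d)) = (y b + 1) * (\<Prod>d\<in>C - {c}. y d + of_bool (c < d))"
        using b c insert.hyps by simp
    qed
    also have "\<dots> = (y b + 1) * ((\<Prod>d\<in>C. y d + of_bool (R d)) - (\<Prod>d\<in>C. y d))"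
      by (simp only: sum_distrib_left[symmetric] insert.IH)
    finally show ?thesis
      using b True insert.hyps(1) by (simp add: algebra_simps)
  qed
qed simp

text \<open>Without bars the framed word must increase. A letter outside the interval gives a factor
  0, unless b < c < a, and then \<open>bar_count\<close> is 0 by its first clause.\<close>

lemma bar_count_0:
  assumes "finite C" "C \<noteq> {}" "a \<notin> C" "b \<notin> C"
  shows "bar_count 0 a b C = of_bool (\<forall>c\<in>C. a < c \<and> c < b)"
proof (cases "a > b")
  case True
  then show ?thesis
    using assms(2) by (auto simp: bar_count_def)
next
  case False
  show ?thesis
  proof (cases "\<forall>c\<in>C. a < c \<and> c < b")
    case True
    then show ?thesis
      using False by (auto simp: bar_count_def)
  next
    case not_all: False
    then obtain c where c: "c \<in> C" "\<not> (a < c \<and> c < b)"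
      by blast
    then have "c \<noteq> a" "c \<noteq> b"
      using assms by auto
    then have "real 0 - 1 + of_bool (c < b) + of_bool (a < c) = 0"
      using c(2) False by auto
    then have "(\<Prod>c\<in>C. real 0 - 1 + of_bool (c < b) + of_bool (a < c)) = 0"
      using assms(1) c(1) by (intro prod_zero bexI[of _ c])
    moreover have "of_bool (\<forall>c\<in>C. a < c \<and> c < b) = (0 :: real)"
      using not_all by simp
    ultimately show ?thesis
      using False unfolding bar_count_def by simp
  qed
qed

text \<open>An increasing word must start with the minimum, so at most one term survives.\<close>

lemma sum_bar_count_0:
  assumes "finite C" "C \<noteq> {}" "b \<notin> C"
  shows "(\<Sum>c | c \<in> C \<and> R c. bar_count 0 c b (C - {c})) = of_bool (R (Min C) \<and> (\<forall>c\<in>C. c < b))"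
proof -
  have *: "bar_count 0 c b (C - {c}) = of_bool (c = Min C \<and> (\<forall>d\<in>C. d < b))" if c: "c \<in> C" for c
  proof (cases "C = {c}")
    case True
    then show ?thesis
      using assms(3) by (auto simp: bar_count_def)
  next
    case False
    then have "C - {c} \<noteq> {}"
      using c by auto
    then have "bar_count 0 c b (C - {c}) = of_bool (\<forall>d\<in>C - {c}. c < d \<and> d < b)"
      using assms by (intro bar_count_0) auto
    also have "(\<forall>d\<in>C - {c}. c < d \<and> d < b) \<longleftrightarrow> c = Min C \<and> (\<forall>d\<in>C. d < b)"
    proof
      assume L: "\<forall>d\<in>C - {c}. c < d \<and> d < b"
      then have "c \<le> y" if "y \<in> C" for y
        using that by (cases "y = c") (simp_all add: less_imp_le)
      then have "Min C = c"
        using c assms(1) by (intro Min_eqI) simp_all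
      moreover obtain d where "d \<in> C - {c}"
        using \<open>C - {c} \<noteq> {}\<close> by auto
      then have "c < b"
        using L by force
      ultimately show "c = Min C \<and> (\<forall>d\<in>C. d < b)"
        using L by auto
    next
      assume "c = Min C \<and> (\<forall>d\<in>C. d < b)"
      then show "\<forall>d\<in>C - {c}. c < d \<and> d < b"
        using assms(1) Min_le by (metis DiffD1 DiffD2 insertI1 le_neq_implies_less)
    qed
    finally show ?thesis .
  qed
  have "(\<Sum>c | c \<in> C \<and> R c. bar_count 0 c b (C - {c})) =
      (\<Sum>c | c \<in> C \<and> R c. if c = Min C then of_bool (\<forall>d\<in>C. d < b) else 0)"
    by (intro sum.cong refl) (auto simp: *)
  also have "\<dots> = of_bool (R (Min C) \<and> (\<forall>c\<in>C. c < b))"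
    using assms(1,2) Min_in[of C] by (subst sum.delta) auto
  finally show ?thesis .
qed

lemma bar_count_pos: "bar_count (Suc m) a b C = (\<Prod>c\<in>C. (real m + of_bool (c < b)) + of_bool (a < c))"
  by (simp add: bar_count_def)

lemma sum_bar_count_Suc:
  assumes "finite C" and "\<And>c d. R c \<Longrightarrow> c < d \<Longrightarrow> R d"
  shows "(\<Sum>c | c \<in> C \<and> R c. bar_count (Suc m) c b (C - {c})) =
    (\<Prod>d\<in>C. (real m + of_bool (d < b)) + of_bool (R d)) - (\<Prod>d\<in>C. real m + of_bool (d < b))"
  unfolding bar_count_pos by (rule prod_add_upper_set[OF assms])

lemma sum_split_at:
  fixes C :: "'a :: linorder set"
  assumes "finite C" "a \<notin> C"
  shows "sum F C = (\<Sum>c | c \<in> C \<and> a < c. F c) + (\<Sum>c | c \<in> C \<and> c < a. F c)"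
proof -
  have "{c. c \<in> C \<and> a < c} \<union> {c. c \<in> C \<and> c < a} = C"
    using assms(2) by (auto, metis linorder_neqE)
  moreover have "sum F ({c. c \<in> C \<and> a < c} \<union> {c. c \<in> C \<and> c < a}) =
      (\<Sum>c | c \<in> C \<and> a < c. F c) + (\<Sum>c | c \<in> C \<and> c < a. F c)"
    by (rule sum.union_disjoint) (use assms(1) in auto)
  ultimately show ?thesis
    by (simp only:)
qed

text \<open>For m > 0, telescope over all first letters and subtract those above \<open>a\<close>; m
  = 0 is a matter of increasing words.\<close>

lemma sum_bar_count_below:
  assumes "finite C" "C \<noteq> {}" "a \<notin> C" "b \<notin> C"
  shows "(\<Sum>c | c \<in> C \<and> c < a. bar_count m c b (C - {c})) = (\<Prod>d\<in>C. real m + of_bool (d < b)) - bar_count m a b C"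
proof (cases m)
  case 0
  have Min: "Min C < a \<longleftrightarrow> \<not> (\<forall>c\<in>C. a < c)"
    using assms by (simp add: Min_less_iff) (metis linorder_neqE_nat not_less_iff_gr_or_eq)
  have "(\<Prod>d\<in>C. of_bool (d < b)) = (of_bool (\<forall>d\<in>C. d < b) :: real)"
    using assms(1) by (induction C rule: finite_induct) auto
  then show ?thesis
    using 0 assms by (auto simp: sum_bar_count_0 bar_count_0 Min)
next
  case (Suc k)
  have "(\<Sum>c\<in>C. bar_count m c b (C - {c})) =
      (\<Sum>c | c \<in> C \<and> a < c. bar_count m c b (C - {c})) + (\<Sum>c | c \<in> C \<and> c < a. bar_count m c b (C - {c}))"
    by (rule sum_split_at) (use assms in auto)
  moreover have "(\<Sum>c\<in>C. bar_count (Suc k) c b (C - {c})) =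
      (\<Prod>d\<in>C. (real k + of_bool (d < b)) + 1) - (\<Prod>d\<in>C. real k + of_bool (d < b))"
    using sum_bar_count_Suc[OF assms(1), of "\<lambda>_. True"] by simp
  moreover have "(\<Sum>c | c \<in> C \<and> a < c. bar_count (Suc k) c b (C - {c})) =
      bar_count (Suc k) a b C - (\<Prod>d\<in>C. real k + of_bool (d < b))"
    unfolding bar_count_pos[of _ a] by (rule sum_bar_count_Suc[OF assms(1)]) auto
  ultimately show ?thesis
    unfolding Suc by (simp add: add_ac)
qed

lemma sum_bar_count_above:
  assumes "finite C" "C \<noteq> {}" "a \<notin> C" "b \<notin> C"
  shows "(\<Sum>c | c \<in> C \<and> a < c. bar_count m c b (C - {c})) =
    bar_count m a b C - (if m = 0 then 0 else \<Prod>d\<in>C. real (m - 1) + of_bool (d < b))"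
proof (cases m)
  case 0
  have Min: "a < Min C \<longleftrightarrow> (\<forall>c\<in>C. a < c)"
    using assms by simp
  show ?thesis
    using 0 assms by (auto simp: sum_bar_count_0 bar_count_0 Min)
next
  case (Suc k)
  have "(\<Sum>c | c \<in> C \<and> a < c. bar_count (Suc k) c b (C - {c})) =
      bar_count (Suc k) a b C - (\<Prod>d\<in>C. real k + of_bool (d < b))"
    unfolding bar_count_pos[of _ a] by (rule sum_bar_count_Suc[OF assms(1)]) auto
  then show ?thesis
    by (simp add: Suc)
qed

lemma order_gf_empty: "order_gf a b {} = fps_X ^ (if a > b then 1 else 0)"
proof -
  have "((1 - fps_X) * Abs_fps (\<lambda>m. bar_count m a b {})) $ n = fps_X ^ (if a > b then 1 else 0) $ n" for n
    unfolding fps_one_minus_X_mult_nth by (auto simp: bar_count_def)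
  then show ?thesis
    by (simp add: order_gf_def fps_eq_iff)
qed

text \<open>Split by the first letter \<open>c\<close>, a descent from \<open>a\<close> when
  \<open>c < a\<close>. The sum over c > a at m and the sum over c < a at m - 1 contain the same
  product with opposite signs; what remains is the difference of \<open>bar_count\<close> produced
  by the factor 1 - t.\<close>

lemma order_gf_rec:
  assumes "finite C" "C \<noteq> {}" "a \<notin> C" "b \<notin> C"
  shows "order_gf a b C = (\<Sum>c\<in>C. fps_X ^ (if a > c then 1 else 0) * order_gf c b (C - {c}))"
proof -
  let ?B = "\<lambda>c. Abs_fps (\<lambda>m. bar_count m c b (C - {c}))"
  have "(1 - fps_X) * Abs_fps (\<lambda>m. bar_count m a b C) = (\<Sum>c\<in>C. fps_X ^ (if a > c then 1 else 0) * ?B c)"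
  proof (rule fps_ext)
    fix m
    have "(\<Sum>c\<in>C. fps_X ^ (if a > c then 1 else 0) * ?B c) $ m =
        (\<Sum>c\<in>C. (fps_X ^ (if a > c then 1 else 0) * ?B c) $ m)"
      by (rule fps_sum_nth)
    also have "\<dots> = (\<Sum>c | c \<in> C \<and> a < c. (fps_X ^ (if a > c then 1 else 0) * ?B c) $ m) +
        (\<Sum>c | c \<in> C \<and> c < a. (fps_X ^ (if a > c then 1 else 0) * ?B c) $ m)"
      by (rule sum_split_at) (use assms in auto)
    also have "(\<Sum>c | c \<in> C \<and> a < c. (fps_X ^ (if a > c then 1 else 0) * ?B c) $ m) =
        (\<Sum>c | c \<in> C \<and> a < c. bar_count m c b (C - {c}))"
      by (intro sum.cong) auto
    also have "(\<Sum>c | c \<in> C \<and> c < a. (fps_X ^ (if a > c then 1 else 0) * ?B c) $ m) =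
        (if m = 0 then 0 else \<Sum>c | c \<in> C \<and> c < a. bar_count (m - 1) c b (C - {c}))"
      by (auto intro!: sum.cong)
    finally show "((1 - fps_X) * Abs_fps (\<lambda>m. bar_count m a b C)) $ m =
        (\<Sum>c\<in>C. fps_X ^ (if a > c then 1 else 0) * ?B c) $ m"
      unfolding sum_bar_count_above[OF assms] sum_bar_count_below[OF assms]
      by (simp add: fps_one_minus_X_mult_nth)
  qed
  then have "order_gf a b C = (1 - fps_X) ^ card C * (\<Sum>c\<in>C. fps_X ^ (if a > c then 1 else 0) * ?B c)"
    by (simp only: order_gf_def power_Suc2 mult.assoc)
  also have "\<dots> = (\<Sum>c\<in>C. fps_X ^ (if a > c then 1 else 0) * order_gf c b (C - {c}))"
    unfolding sum_distrib_left
  proof (intro sum.cong refl)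
    fix c assume "c \<in> C"
    then have "Suc (card (C - {c})) = card C"
      using assms(1) by (metis card.remove)
    then show "(1 - fps_X) ^ card C * (fps_X ^ (if a > c then 1 else 0) * ?B c) =
        fps_X ^ (if a > c then 1 else 0) * order_gf c b (C - {c})"
      unfolding order_gf_def by (simp only: mult.left_commute)
  qed
  finally show ?thesis .
qed

lemma fact_fps_const: "(fact k :: real fps) * fps_const (1 / fact k) = 1"
proof -
  have "(fact k :: real fps) = of_nat (fact k)"
    by simp
  also have "\<dots> = fps_const (fact k)"
    by (simp add: fps_of_nat[symmetric] del: of_nat_fact) (simp add: fps_of_nat)
  finally show ?thesis
    by simp
qed

text \<open>When both ends are \<open>a\<close>, every letter is either above or below
  \<open>a\<close>, so each factor is m whatever the value of \<open>a\<close>.\<close>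

lemma order_gf_cyclic:
  assumes "a \<notin> C"
  shows "order_gf a a C = fact (card C) * eulerian_egf $ card C"
proof -
  have "bar_count m a a C = real m ^ card C" for m
  proof -
    have "(\<Prod>c\<in>C. real m - 1 + of_bool (c < a) + of_bool (a < c)) = (\<Prod>c\<in>C. real m)"
      using assms by (intro prod.cong refl) (auto, metis linorder_neqE_nat)
    then show ?thesis
      by (simp add: bar_count_def)
  qed
  then show ?thesis
    using fact_fps_const[of "card C"]
    by (simp only: order_gf_def eulerian_egf_def fps_nth_Abs_fps mult.assoc[symmetric] mult_1_left)
qed

section \<open>Descents of quasi-Stirling words\<close>

definition path_gf :: "nat \<Rightarrow> nat \<Rightarrow> nat set \<Rightarrow> real fps" where
  "path_gf a b S = (\<Sum>w\<in>qs_words S. fps_X ^ path_des a w b)"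

lemma path_gf_empty: "path_gf a b {} = fps_X ^ (if a > b then 1 else 0)"
  by (simp add: path_gf_def)

lemma path_gf_rec:
  assumes "finite S" "S \<noteq> {}"
  shows "path_gf a b S = (\<Sum>c\<in>S. \<Sum>U\<in>Pow (S - {c}).
    fps_X ^ (if a > c then 1 else 0) * path_gf c c U * path_gf c b (S - {c} - U))"
  unfolding path_gf_def sum_qs_words[OF assms]
  by (rule sum.cong[OF refl], rule sum.cong[OF refl], unfold mult.assoc sum_product, unfold sum_distrib_left)
     (simp only: path_des.simps path_des_append power_add mult.assoc)

section \<open>Exponential generating functions of words and their nested parts\<close>

definition qs_egf :: "real fps fps" where
  "qs_egf = Abs_fps (\<lambda>n. fps_const (1 / fact n) * path_gf 0 0 {1..n})"

lemma path_gf_eq_qs_egf: "path_gf 0 0 {1..n} = fact n * qs_egf $ n"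
  using fact_fps_const[of n] by (simp add: qs_egf_def mult.assoc[symmetric])

text \<open>Counts the ways to distribute l letters into the k ordered, possibly empty, words
  enclosed by k outer letters.\<close>

definition forest_gf :: "nat \<Rightarrow> nat \<Rightarrow> real fps" where
  "forest_gf k l = fact l * (qs_egf ^ k) $ l"

lemma fact_choose:
  assumes "u \<le> l"
  shows "of_nat (l choose u) * (fact u * fact (l - u)) = (fact l :: 'a :: {comm_semiring_1, semiring_char_0})"
proof -
  have "of_nat ((l choose u) * (fact u * fact (l - u))) = (of_nat (fact l) :: 'a)"
    using binomial_fact_lemma[OF assms] by (simp only: mult_ac)
  then show ?thesis
    by simp
qed

lemma forest_gf_Suc:
  "forest_gf (Suc k) l = (\<Sum>u\<le>l. of_nat (l choose u) * (path_gf 0 0 {1..u} * forest_gf k (l - u)))"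
proof -
  have "forest_gf (Suc k) l = (\<Sum>u\<le>l. fact l * (qs_egf $ u * (qs_egf ^ k) $ (l - u)))"
    by (simp add: forest_gf_def fps_mult_nth sum_distrib_left atLeast0AtMost)
  also have "\<dots> = (\<Sum>u\<le>l. of_nat (l choose u) * (path_gf 0 0 {1..u} * forest_gf k (l - u)))"
  proof (intro sum.cong refl)
    fix u assume "u \<in> {..l}"
    then have "(fact l :: real fps) = of_nat (l choose u) * (fact u * fact (l - u))"
      by (intro fact_choose[symmetric]) simp
    then show "fact l * (qs_egf $ u * (qs_egf ^ k) $ (l - u)) =
        of_nat (l choose u) * (path_gf 0 0 {1..u} * forest_gf k (l - u))"
      by (simp only: path_gf_eq_qs_egf forest_gf_def mult_ac)
  qed
  finally show ?thesis .
qed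

lemma forest_gf_0: "forest_gf 0 l = (if l = 0 then 1 else 0)"
  by (simp add: forest_gf_def)

lemma sum_Pow_card:
  fixes F :: "nat \<Rightarrow> 'a :: comm_semiring_1"
  assumes "finite V"
  shows "(\<Sum>U\<in>Pow V. F (card U)) = (\<Sum>u\<le>card V. of_nat (card V choose u) * F u)"
proof -
  have "(\<Sum>U\<in>Pow V. F (card U)) = (\<Sum>u\<le>card V. \<Sum>U | U \<in> Pow V \<and> card U = u. F (card U))"
    by (rule sum.group[symmetric]) (use assms in \<open>auto intro: card_mono\<close>)
  also have "\<dots> = (\<Sum>u\<le>card V. of_nat (card V choose u) * F u)"
  proof (intro sum.cong refl)
    fix u
    have "(\<Sum>U | U \<in> Pow V \<and> card U = u. F (card U)) = (\<Sum>U | U \<in> Pow V \<and> card U = u. F u)"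
      by (intro sum.cong) auto
    then show "(\<Sum>U | U \<in> Pow V \<and> card U = u. F (card U)) = of_nat (card V choose u) * F u"
      using n_subsets[OF assms, of u] by simp
  qed
  finally show ?thesis .
qed

lemma sum_Pow_swap:
  fixes F :: "'a set \<Rightarrow> 'a set \<Rightarrow> 'b :: comm_monoid_add"
  assumes "finite T"
  shows "(\<Sum>U\<in>Pow T. \<Sum>C\<in>Pow (T - U). F U C) = (\<Sum>C\<in>Pow T. \<Sum>U\<in>Pow (T - C). F U C)"
proof -
  have *: "Pow (T - U) = {C. C \<in> Pow T \<and> U \<inter> C = {}}" "Pow (T - U) = {C. C \<in> Pow T \<and> C \<inter> U = {}}" for U
    by auto
  have "(\<Sum>U\<in>Pow T. \<Sum>C\<in>Pow (T - U). F U C) = (\<Sum>U\<in>Pow T. \<Sum>C | C \<in> Pow T \<and> U \<inter> C = {}. F U C)"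
    by (simp only: *(1))
  also have "\<dots> = (\<Sum>C\<in>Pow T. \<Sum>U | U \<in> Pow T \<and> U \<inter> C = {}. F U C)"
    by (rule sum.swap_restrict) (use assms in auto)
  also have "\<dots> = (\<Sum>C\<in>Pow T. \<Sum>U\<in>Pow (T - C). F U C)"
    by (simp only: *(2))
  finally show ?thesis .
qed

text \<open>A nonempty set with a marked element is an element together with a subset of the
  rest.\<close>

lemma sum_Pow_pointed:
  fixes F :: "'a \<Rightarrow> 'a set \<Rightarrow> 'b :: comm_monoid_add"
  assumes "finite S"
  shows "(\<Sum>C\<in>Pow S - {{}}. \<Sum>c\<in>C. F c (C - {c})) = (\<Sum>c\<in>S. \<Sum>C\<in>Pow (S - {c}). F c C)"
proof -
  have fin: "finite C" if "C \<subseteq> S" for C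
    using that assms finite_subset by blast
  have "(\<Sum>C\<in>Pow S - {{}}. \<Sum>c\<in>C. F c (C - {c})) = (\<Sum>(C, c)\<in>(SIGMA C:Pow S - {{}}. C). F c (C - {c}))"
    using assms fin by (subst sum.Sigma) auto
  also have "\<dots> = (\<Sum>(c, C)\<in>(SIGMA c:S. Pow (S - {c})). F c C)"
    by (rule sum.reindex_bij_witness[where i = "\<lambda>(c, C). (insert c C, c)" and j = "\<lambda>(C, c). (c, C - {c})"])
       auto
  also have "\<dots> = (\<Sum>c\<in>S. \<Sum>C\<in>Pow (S - {c}). F c C)"
    using assms fin by (subst sum.Sigma) auto
  finally show ?thesis .
qed

text \<open>Group the words by the set \<open>C\<close> of letters that are not nested inside another letter. The
  enclosed words only contribute through their sizes, because \<open>path_gf c c U\<close> depends only on the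
  size of \<open>U\<close>; this in turn follows from the present expansion for \<open>U\<close>.\<close>

lemma path_gf_expansion:
  assumes "finite S" "a \<notin> S" "b \<notin> S"
  shows "path_gf a b S = (\<Sum>C\<in>Pow S. order_gf a b C * forest_gf (card C) (card S - card C))"
  using assms
proof (induction "card S" arbitrary: S a b rule: less_induct)
  case less
  \<comment> \<open>For sets smaller than \<open>S\<close> the induction hypothesis applies, and in
    the cyclic case its right-hand side mentions only the size.\<close>
  have cyclic: "path_gf c c U = path_gf 0 0 {1..card U}"
    if U: "finite U" "card U < card S" "c \<notin> U" for c U
  proof -
    have *: "path_gf d d V = (\<Sum>u\<le>card V. of_nat (card V choose u) *
        (fact u * eulerian_egf $ u * forest_gf u (card V - u)))"
      if V: "finite V" "card V < card S" "d \<notin> V" for d V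
    proof -
      have "path_gf d d V = (\<Sum>C\<in>Pow V. order_gf d d C * forest_gf (card C) (card V - card C))"
        using less.hyps[of V d d] V by simp
      also have "\<dots> = (\<Sum>C\<in>Pow V. fact (card C) * eulerian_egf $ card C * forest_gf (card C) (card V - card C))"
        using V(3) by (intro sum.cong refl, subst order_gf_cyclic) auto
      also have "\<dots> = (\<Sum>u\<le>card V. of_nat (card V choose u) *
          (fact u * eulerian_egf $ u * forest_gf u (card V - u)))"
        by (rule sum_Pow_card[OF V(1), of "\<lambda>u. fact u * eulerian_egf $ u * forest_gf u (card V - u)"])
      finally show ?thesis .
    qed
    show ?thesis
      using *[of U c] *[of "{1..card U}" 0] U by simp
  qed
  show ?case
  proof (cases "S = {}")
    case True
    then show ?thesis
      by (simp add: path_gf_empty order_gf_empty forest_gf_0)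
  next
    case False
    define X where "X c = (fps_X :: real fps) ^ (if a > c then 1 else 0)" for c
    \<comment> \<open>For a fixed first letter \<open>c\<close>, \<open>U\<close> is enclosed by
      \<open>c\<close> and \<open>C\<close> holds the later outer letters. Summing over
      \<open>U\<close> first merges its word into the forest, giving \<open>Suc (card C)\<close>
      enclosed words.\<close>
    have inner: "(\<Sum>U\<in>Pow T. X c * path_gf c c U * path_gf c b (T - U)) =
        (\<Sum>C\<in>Pow T. X c * order_gf c b C * forest_gf (Suc (card C)) (card T - card C))"
      if c: "c \<in> S" and T: "T = S - {c}" for c T
    proof -
      have fT: "finite T" and cT: "card T < card S"
        using less.prems(1) c by (simp_all only: T finite_Diff card_Diff1_less)
      have "(\<Sum>U\<in>Pow T. X c * path_gf c c U * path_gf c b (T - U)) =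
          (\<Sum>U\<in>Pow T. \<Sum>C\<in>Pow (T - U). X c * order_gf c b C *
            (path_gf 0 0 {1..card U} * forest_gf (card C) (card T - card C - card U)))"
      proof (intro sum.cong refl)
        fix U assume U: "U \<in> Pow T"
        then have fU: "finite U" "card U \<le> card T"
          using fT finite_subset by (auto intro: card_mono)
        have "path_gf c c U = path_gf 0 0 {1..card U}"
          using U fU cT T by (intro cyclic) auto
        moreover have "path_gf c b (T - U) =
            (\<Sum>C\<in>Pow (T - U). order_gf c b C * forest_gf (card C) (card (T - U) - card C))"
        proof (rule less.hyps)
          show "card (T - U) < card S"
            using card_mono[of T "T - U"] fT cT by auto
        qed (use fT T less.prems in auto)
        moreover have "card (T - U) - card C = card T - card C - card U" for C :: "nat set"
          using U fU by (subst card_Diff_subset) auto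
        ultimately show "X c * path_gf c c U * path_gf c b (T - U) = (\<Sum>C\<in>Pow (T - U). X c * order_gf c b C *
            (path_gf 0 0 {1..card U} * forest_gf (card C) (card T - card C - card U)))"
          by (simp only: sum_distrib_left mult_ac)
      qed
      also have "\<dots> = (\<Sum>C\<in>Pow T. \<Sum>U\<in>Pow (T - C). X c * order_gf c b C *
            (path_gf 0 0 {1..card U} * forest_gf (card C) (card T - card C - card U)))"
        by (rule sum_Pow_swap[OF fT])
      also have "\<dots> = (\<Sum>C\<in>Pow T. X c * order_gf c b C * forest_gf (Suc (card C)) (card T - card C))"
      proof (intro sum.cong refl)
        fix C assume "C \<in> Pow T"
        then have "card (T - C) = card T - card C"
          using fT finite_subset by (intro card_Diff_subset) auto
        then have "(\<Sum>U\<in>Pow (T - C). path_gf 0 0 {1..card U} * forest_gf (card C) (card T - card C - card U)) =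
            forest_gf (Suc (card C)) (card T - card C)"
          using sum_Pow_card[of "T - C" "\<lambda>u. path_gf 0 0 {1..u} * forest_gf (card C) (card T - card C - u)"] fT
          by (simp only: forest_gf_Suc finite_Diff)
        then show "(\<Sum>U\<in>Pow (T - C). X c * order_gf c b C *
            (path_gf 0 0 {1..card U} * forest_gf (card C) (card T - card C - card U))) =
            X c * order_gf c b C * forest_gf (Suc (card C)) (card T - card C)"
          by (simp only: sum_distrib_left[symmetric])
      qed
      finally show ?thesis .
    qed
    have "path_gf a b S = (\<Sum>c\<in>S. \<Sum>U\<in>Pow (S - {c}). X c * path_gf c c U * path_gf c b (S - {c} - U))"
      unfolding X_def by (rule path_gf_rec[OF less.prems(1) False])
    also have "\<dots> = (\<Sum>c\<in>S. \<Sum>C\<in>Pow (S - {c}). X c * order_gf c b C *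
        forest_gf (Suc (card C)) (card (S - {c}) - card C))"
      by (intro sum.cong refl inner)
    also have "\<dots> = (\<Sum>C\<in>Pow S - {{}}. \<Sum>c\<in>C. X c * order_gf c b (C - {c}) *
        forest_gf (Suc (card (C - {c}))) (card (S - {c}) - card (C - {c})))"
      by (rule sum_Pow_pointed[OF less.prems(1), symmetric])
    also have "\<dots> = (\<Sum>C\<in>Pow S - {{}}. order_gf a b C * forest_gf (card C) (card S - card C))"
    proof (intro sum.cong refl)
      fix C assume "C \<in> Pow S - {{}}"
      then have C: "C \<subseteq> S" "C \<noteq> {}" "finite C"
        using less.prems(1) finite_subset by auto
      have "(\<Sum>c\<in>C. X c * order_gf c b (C - {c}) * forest_gf (Suc (card (C - {c}))) (card (S - {c}) - card (C - {c}))) =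
          (\<Sum>c\<in>C. X c * order_gf c b (C - {c}) * forest_gf (card C) (card S - card C))"
      proof (intro sum.cong refl)
        fix c assume c: "c \<in> C"
        then have "Suc (card (C - {c})) = card C" "Suc (card (S - {c})) = card S"
          using C less.prems(1) by (metis card.remove subsetD)+
        then have "card (S - {c}) - card (C - {c}) = card S - card C"
          by linarith
        then show "X c * order_gf c b (C - {c}) * forest_gf (Suc (card (C - {c}))) (card (S - {c}) - card (C - {c})) =
            X c * order_gf c b (C - {c}) * forest_gf (card C) (card S - card C)"
          using \<open>Suc (card (C - {c})) = card C\<close> by (simp only:)
      qed
      also have "\<dots> = order_gf a b C * forest_gf (card C) (card S - card C)"
      proof -
        have "order_gf a b C = (\<Sum>c\<in>C. X c * order_gf c b (C - {c}))"
          unfolding X_def using C less.prems by (intro order_gf_rec) auto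
        then show ?thesis
          by (simp only: sum_distrib_right)
      qed
      finally show "(\<Sum>c\<in>C. X c * order_gf c b (C - {c}) *
          forest_gf (Suc (card (C - {c}))) (card (S - {c}) - card (C - {c}))) =
          order_gf a b C * forest_gf (card C) (card S - card C)" .
    qed
    also have "\<dots> = (\<Sum>C\<in>Pow S. order_gf a b C * forest_gf (card C) (card S - card C))"
    proof -
      \<comment> \<open>Without outer letters nothing can enclose the nonempty set
        \<open>S\<close>.\<close>
      have "forest_gf (card {}) (card S - card {}) = 0"
        using False less.prems(1) by (simp add: forest_gf_0)
      then show ?thesis
        using less.prems(1) by (subst sum.remove[of "Pow S" "{}"]) auto
    qed
    finally show ?thesis .
  qed
qed

text \<open>The expansion with zero frame, grouped by the number k of outer letters: their order
  gives an Eulerian polynomial, and the words they enclose give the k-th power of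
  \<open>qs_egf\<close>.\<close>

lemma qs_egf_eq: "qs_egf = eulerian_egf oo (fps_X * qs_egf)"
proof (rule fps_ext)
  fix n
  have "path_gf 0 0 {1..n} = (\<Sum>C\<in>Pow {1..n}. order_gf 0 0 C * forest_gf (card C) (n - card C))"
    by (subst path_gf_expansion) auto
  also have "\<dots> = (\<Sum>C\<in>Pow {1..n}. fact (card C) * eulerian_egf $ card C * forest_gf (card C) (n - card C))"
    by (intro sum.cong refl, subst order_gf_cyclic) auto
  also have "\<dots> = (\<Sum>k\<le>n. of_nat (n choose k) * (fact k * eulerian_egf $ k * forest_gf k (n - k)))"
    using sum_Pow_card[of "{1..n}" "\<lambda>k. fact k * eulerian_egf $ k * forest_gf k (n - k)"] by simp
  also have "\<dots> = (\<Sum>k\<le>n. fact n * (eulerian_egf $ k * ((fps_X * qs_egf) ^ k) $ n))"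
  proof (intro sum.cong refl)
    fix k assume k: "k \<in> {..n}"
    then have "((fps_X * qs_egf) ^ k) $ n = (qs_egf ^ k) $ (n - k)"
      by (simp add: power_mult_distrib fps_X_power_mult_nth)
    moreover have "(fact n :: real fps) = of_nat (n choose k) * (fact k * fact (n - k))"
      using k by (intro fact_choose[symmetric]) simp
    ultimately show "of_nat (n choose k) * (fact k * eulerian_egf $ k * forest_gf k (n - k)) =
        fact n * (eulerian_egf $ k * ((fps_X * qs_egf) ^ k) $ n)"
      by (simp only: forest_gf_def mult_ac)
  qed
  also have "\<dots> = fact n * (eulerian_egf oo (fps_X * qs_egf)) $ n"
    by (simp add: fps_compose_nth sum_distrib_left atLeast0AtMost)
  finally have "fact n * qs_egf $ n = fact n * (eulerian_egf oo (fps_X * qs_egf)) $ n"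
    by (simp only: path_gf_eq_qs_egf)
  then show "qs_egf $ n = (eulerian_egf oo (fps_X * qs_egf)) $ n"
    by (simp add: mult_left_cancel)
qed

section \<open>Comparison of \<open>Qbar_poly\<close> with \<open>J_poly\<close>\<close>

lemma fps_Qbar_poly: "fps_of_poly (Qbar_poly n) = path_gf 0 0 {1..n}"
proof -
  have "des w = path_des 0 w 0" if "w \<in> qs_words {1..n}" for w
    using that by (intro path_des_eq_des[symmetric]) (auto simp: qs_words_def)
  then show ?thesis
    by (simp add: Qbar_poly_def path_gf_def quasi_stirling_eq_qs_words fps_of_poly_sum fps_of_poly_monom')
qed

text \<open>Lagrange inversion and \<open>fps_J_poly\<close> with d = n - 1 give series with the
  same power of 1 - t; their coefficients agree because (n + 1) C(m+n, n+1) = m C(m+n, n).\<close>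

lemma Qbar_poly_eq_J_poly:
  assumes "n \<ge> 1"
  shows "Qbar_poly n = [:0, 1:] * J_poly (2 * n) (Suc n)"
proof -
  obtain d where d: "n = Suc d"
    using assms by (cases n) auto
  let ?c = "of_nat (Suc n) :: real fps"
  let ?B = "Abs_fps (\<lambda>m. of_nat ((m + n) choose n) * of_nat m ^ n) :: real fps"
  have "?c * qs_egf $ n = (eulerian_egf ^ Suc n) $ n"
    by (rule lagrange_inversion[OF qs_egf_eq])
  also have "\<dots> = fps_const (1 / fact n) * ((1 - fps_X) ^ (n + Suc n) * ?B)"
    by (simp only: eulerian_egf_power mult.assoc)
  finally have "fact n * (?c * qs_egf $ n) = (fact n * fps_const (1 / fact n)) * ((1 - fps_X) ^ (n + Suc n) * ?B)"
    by (simp only: mult.assoc)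
  then have Q: "?c * fps_of_poly (Qbar_poly n) = (1 - fps_X) ^ (n + Suc n) * ?B"
    by (simp only: fps_Qbar_poly path_gf_eq_qs_egf fact_fps_const mult_1_left mult.left_commute)
  have "?B = ?c * Abs_fps (\<lambda>m. of_nat m ^ d * of_nat ((m + n) choose Suc n))"
  proof (rule fps_ext)
    fix m
    have "Suc n * ((m + n) choose Suc n) = m * ((m + n) choose n)"
    proof (cases m)
      case (Suc k)
      then show ?thesis
        using Suc_times_binomial_add[of n k] by (simp add: add.commute)
    qed simp
    then have "real (Suc n) * real ((m + n) choose Suc n) = real m * real ((m + n) choose n)"
      by (simp only: of_nat_mult[symmetric])
    then show "?B $ m = (?c * Abs_fps (\<lambda>m. of_nat m ^ d * of_nat ((m + n) choose Suc n))) $ m"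
      by (simp add: d fps_of_nat[symmetric] del: of_nat_Suc)
  qed
  moreover have "fps_X * fps_of_poly (J_poly (2 * n) (Suc n)) = (1 - fps_X) ^ (n + Suc n) *
      Abs_fps (\<lambda>m. of_nat m ^ d * of_nat ((m + n) choose Suc n))"
    using fps_J_poly[of n d] d by (simp add: mult_2)
  ultimately have "?c * fps_of_poly (Qbar_poly n) = ?c * (fps_X * fps_of_poly (J_poly (2 * n) (Suc n)))"
    unfolding Q by (simp only: mult.left_commute)
  moreover have "?c \<noteq> 0"
    by (simp del: of_nat_Suc)
  ultimately have "fps_of_poly (Qbar_poly n) = fps_of_poly ([:0, 1:] * J_poly (2 * n) (Suc n))"
    unfolding fps_of_poly_mult fps_of_poly_fps_X by (metis mult_left_cancel)
  then show ?thesis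
    by (simp only: fps_of_poly_eq_iff)
qed

theorem theorem3p2:
  fixes n r :: nat
  assumes "1 \<le> r" and "r \<le> n"
  shows "real_distinct_nonpos_roots (A_poly n r) \<and>
         real_distinct_nonpos_roots (J_poly n r) \<and>
         real_distinct_nonpos_roots (Qbar_poly n)"
proof (intro conjI)
  show "real_distinct_nonpos_roots (A_poly n r)"
    by (rule has_neg_simple_roots_imp_real_distinct_nonpos_roots[OF A_poly_neg_simple_roots[OF assms]])
  show "real_distinct_nonpos_roots (J_poly n r)"
    by (rule has_neg_simple_roots_imp_real_distinct_nonpos_roots[OF J_poly_neg_simple_roots[OF assms]])
  have n: "1 \<le> n" "1 \<le> Suc n" "Suc n \<le> 2 * n"
    using assms by auto
  show "real_distinct_nonpos_roots (Qbar_poly n)"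
    unfolding Qbar_poly_eq_J_poly[OF n(1)]
    by (rule real_distinct_nonpos_roots_monom_mult[OF J_poly_neg_simple_roots[OF n(2,3)]])
qed

end
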